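(* Let $\mu\in L^\infty(\mathbb{R}^d)$ and let $B\colon L^2(\mathbb{R}^d)\to L^2(\mathbb{R}^d)$ be the Fourier multiplier $Bf=\mathcal{F}^{-1}(\mu\cdot\mathcal{F}f)$. Let $k,\widehat{h}\in L^1(\mathbb{R}^d)\cap L^2(\mathbb{R}^d)$ satisfy $\int k=\int\widehat{h}=1$. For $\alpha,\beta>0$ define $$k_\alpha(x)=\alpha^{-d}k(x/\alpha),\qquad \widehat{h}_\beta(x)=\beta^{-d}\widehat{h}(x/\beta),\qquad h_\beta=\mathcal{F}^{-1}(\widehat{h}_\beta),$$ and $B_{\alpha,\beta}f=\mathcal{F}^{-1}\big(\mu\cdot\mathcal{F}(k_\alpha)\cdot\mathcal{F}(h_\beta f)\big)$. Then for every $f\in L^2(\mathbb{R}^d)$ with $\mathcal{F}f\in L^1(\mathbb{R}^d)$, $$\|B_{\alpha,\beta}f-Bf\|_{L^\infty(\mathbb{R}^d)}\to 0\qquad\text{as }\alpha,\beta\to 0.$$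
   Context: $\mathcal{F}\colon L^2(\mathbb{R}^d)\to L^2(\mathbb{R}^d)$ is the unitary Fourier transform, normalized so that $\mathcal{F}f(\xi)=\int_{\mathbb{R}^d}f(x)e^{-2\pi i x\cdot\xi}\,dx$ for $f\in L^1\cap L^2$; $\mathcal{F}^{-1}$ is its inverse. The limit is the joint limit in $(\alpha,\beta)$. *)

theory Defs
  imports "HOL-Analysis.Analysis" "HOL-Probability.Essential_Supremum"
begin

definition square_integrable :: "('a::euclidean_space \<Rightarrow> complex) \<Rightarrow> bool" where
  "square_integrable f \<longleftrightarrow> f \<in> borel_measurable lebesgue \<and>
     integrable lebesgue (\<lambda>x. (cmod (f x))\<^sup>2)"

definition Linf_norm :: "('a::euclidean_space \<Rightarrow> complex) \<Rightarrow> ereal" where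
  "Linf_norm f = esssup lebesgue (\<lambda>x. ereal (cmod (f x)))"

definition essentially_bounded :: "('a::euclidean_space \<Rightarrow> complex) \<Rightarrow> bool" where
  "essentially_bounded f \<longleftrightarrow> f \<in> borel_measurable lebesgue \<and> Linf_norm f < \<infinity>"

text \<open>Fourier integral with sign s: s = -1 gives the Fourier transform
  (integral of f(x) e^{-2 pi i x.xi}), s = 1 gives the inverse transform. Meaningful for L^1 functions.\<close>
definition fourier_int :: "real \<Rightarrow> ('a::euclidean_space \<Rightarrow> complex) \<Rightarrow> 'a \<Rightarrow> complex" where
  "fourier_int s f \<xi> = integral\<^sup>L lebesgue (\<lambda>x. f x * cis (s * 2 * pi * (x \<bullet> \<xi>)))"

text \<open>Unitary L^2 Fourier transform (s = -1) / inverse (s = 1), defined as the L^2 limit of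
  the Fourier integrals of the truncations f * 1_{ball 0 R} as R tends to infinity
  (a representative of the L^2 class; determined up to null sets).\<close>
definition fourier_L2 :: "real \<Rightarrow> ('a::euclidean_space \<Rightarrow> complex) \<Rightarrow> 'a \<Rightarrow> complex" where
  "fourier_L2 s f = (SOME g. square_integrable g \<and>
      ((\<lambda>R::real. \<integral>\<^sup>+ \<xi>. ennreal ((cmod (fourier_int s (\<lambda>x. indicator (ball 0 R) x * f x) \<xi> - g \<xi>))\<^sup>2) \<partial>lebesgue)
        \<longlongrightarrow> 0) at_top)"

abbreviation FT :: "('a::euclidean_space \<Rightarrow> complex) \<Rightarrow> 'a \<Rightarrow> complex" where
  "FT \<equiv> fourier_L2 (-1)"

abbreviation FT_inv :: "('a::euclidean_space \<Rightarrow> complex) \<Rightarrow> 'a \<Rightarrow> complex" where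
  "FT_inv \<equiv> fourier_L2 1"

definition dilate :: "real \<Rightarrow> ('a::euclidean_space \<Rightarrow> complex) \<Rightarrow> 'a \<Rightarrow> complex" where
  "dilate t g x = complex_of_real (inverse (t ^ DIM('a))) * g ((inverse t) *\<^sub>R x)"

end

theory Submission
  imports Defs "HOL-Probability.Characteristic_Functions"
begin

text \<open>
  Damping \<open>\<bar>fourier_int s f\<bar>\<^sup>2\<close> by Gaussians and applying Fatou gives the Plancherel inequality
  on \<open>L\<^sup>1\<close>, with which Riesz--Fischer makes \<open>fourier_L2\<close> well defined on \<open>L\<^sup>2\<close> and equal to the
  Fourier integral on \<open>L\<^sup>1 \<inter> L\<^sup>2\<close>. Fubini and Young's inequality then identify \<open>FT (h\<^sub>\<beta> f)\<close>
  with the convolution of \<open>dilate \<beta> hhat\<close> and \<open>FT f\<close>. So both terms are Fourier integrals of \<open>L\<^sup>1\<close>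
  functions, and their \<open>L\<^sup>\<infinity>\<close> distance is at most \<open>\<parallel>\<mu>\<parallel>\<^sub>\<infinity>\<close> times
  \<open>\<parallel>k\<parallel>\<^sub>1 \<parallel>hhat\<^sub>\<beta> * FT f - FT f\<parallel>\<^sub>1 + \<parallel>(FT k (\<alpha> \<cdot>) - 1) FT f\<parallel>\<^sub>1\<close>.
  The first summand vanishes by the approximate-identity argument, the second by dominated convergence.
\<close>

subsection \<open>The Plancherel inequality on \<open>L\<^sup>1\<close>\<close>

text \<open>Two features of the formulation shape the proof. \<open>fourier_L2\<close> is a
  \<open>SOME\<close> choice, so nothing is known about its value at a single point; arguments go
  through the relation of being the L^2 limit of the transforms of truncations, which sees its data
  only up to null sets. The data are moreover Lebesgue measurable, whereas Fubini and the
  translation formulas are applied to Borel functions on \<open>lborel\<close>, so Borel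
  representatives are substituted for them. The analytic core is the multiplication formula, which
  moves a Fourier integral from one factor of a product to the other. Combined with Gaussian damping
  it yields the Plancherel bound; combined with modulation by a character it turns products into
  convolutions. The joint limit decouples because the transform of the dilated \<open>k\<close> is
  bounded by the L^1 norm of \<open>k\<close> whatever \<alpha> is. The error is thus controlled by
  one term in \<beta> alone and one in \<alpha> alone, and no relation between the two parameters
  arises.\<close>

lemma has_bochner_integral_gaussian_cis:
  fixes a z :: real
  assumes a: "a > 0"
  shows "has_bochner_integral lborel (\<lambda>t. complex_of_real (exp (- (a * t)\<^sup>2 / 2)) * cis (t * z))
           (complex_of_real (sqrt (2 * pi) / a * exp (- (z / a)\<^sup>2 / 2)))"
proof -
  have std: "has_bochner_integral lborel (\<lambda>t. complex_of_real (exp (- t\<^sup>2 / 2)) * cis (t * y))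
           (complex_of_real (sqrt (2 * pi) * exp (- y\<^sup>2 / 2)))" for y :: real
  proof -
    \<comment> \<open>The characteristic function of the normal law is the transform of its density;
      the factor \<open>sqrt (2 * pi)\<close> applied below removes the normalisation of that
      density.\<close>
    have "(CLINT x|std_normal_distribution. iexp (y * x)) = complex_of_real (exp (- y\<^sup>2 / 2))"
      using char_std_normal_distribution by (simp add: char_def fun_eq_iff)
    moreover have "(CLINT x|std_normal_distribution. iexp (y * x)) =
        (CLINT x|lborel. std_normal_density x *\<^sub>R iexp (y * x))"
      by (subst integral_density) (auto simp: normal_density_nonneg)
    ultimately have eq: "(CLINT x|lborel. std_normal_density x *\<^sub>R iexp (y * x)) = complex_of_real (exp (- y\<^sup>2 / 2))"
      by simp
    have "integrable lborel (\<lambda>x. std_normal_density x *\<^sub>R iexp (y * x))"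
      by (rule Bochner_Integration.integrable_bound[OF integrable_normal_density[of 1 0]])
         (auto simp: normal_density_nonneg)
    with eq have "has_bochner_integral lborel (\<lambda>x. std_normal_density x *\<^sub>R iexp (y * x)) (complex_of_real (exp (- y\<^sup>2 / 2)))"
      by (simp add: has_bochner_integral_iff)
    from has_bochner_integral_mult_right[OF this, of "complex_of_real (sqrt (2*pi))"]
    show ?thesis
      by (simp add: std_normal_density_def scaleR_conv_of_real cis_conv_exp mult_ac)
  qed
  \<comment> \<open>Substituting \<open>a * t\<close> for \<open>t\<close> turns the frequency
    \<open>z / a\<close> into \<open>z\<close> and contributes the Jacobian factor
    \<open>1 / a\<close>.\<close>
  show ?thesis
    using std[of "z / a"] a
    by (subst (asm) lborel_has_bochner_integral_real_affine_iff[of a _ _ 0])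
       (simp_all add: scaleR_conv_of_real mult_ac divide_simps)
qed

text \<open>\<open>lborel\<close> is the image of the product of one-dimensional Lebesgue measures
  under summation of coordinates, so Fubini on the finite product separates the factors.\<close>

lemma has_bochner_integral_lborel_prod:
  fixes f :: "'a::euclidean_space \<Rightarrow> real \<Rightarrow> 'b::{real_normed_field,banach,second_countable_topology}"
  assumes f: "\<And>b. b \<in> Basis \<Longrightarrow> has_bochner_integral lborel (f b) (c b)"
  shows "has_bochner_integral lborel (\<lambda>x. \<Prod>b\<in>Basis. f b (x \<bullet> b)) (\<Prod>b\<in>Basis. c b)"
proof -
  interpret product_sigma_finite "\<lambda>_::'a. lborel :: real measure"
    by standard
  have [measurable]: "\<And>b. b \<in> Basis \<Longrightarrow> f b \<in> borel_measurable borel"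
    using borel_measurable_has_bochner_integral[OF f] by simp
  have int: "\<And>b. b \<in> Basis \<Longrightarrow> integrable lborel (f b)"
    using f by (auto simp: has_bochner_integral_iff)
  have I: "integrable (\<Pi>\<^sub>M b\<in>(Basis::'a set). lborel) (\<lambda>x. \<Prod>b\<in>Basis. f b (x b))"
    by (rule product_integrable_prod[OF finite_Basis int])
  have E: "(\<integral>x. (\<Prod>b\<in>Basis. f b (x b)) \<partial>(\<Pi>\<^sub>M b\<in>(Basis::'a set). lborel)) = (\<Prod>b\<in>Basis. c b)"
    by (subst product_integral_prod[OF finite_Basis int])
       (use f in \<open>auto simp: has_bochner_integral_iff intro!: prod.cong\<close>)
  show ?thesis
    using I E
    by (subst lborel_eq)
       (simp add: has_bochner_integral_iff integrable_distr_eq integral_distr)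
qed

text \<open>Gaussian and character both factor over the coordinates, and each coordinate contributes
  one factor \<open>sqrt (2 * pi) / a\<close>.\<close>

lemma has_bochner_integral_gaussian_cis_euclidean:
  fixes z :: "'a::euclidean_space"
  assumes a: "a > 0"
  shows "has_bochner_integral lborel (\<lambda>x. complex_of_real (exp (- (a * norm x)\<^sup>2 / 2)) * cis (x \<bullet> z))
           (complex_of_real ((sqrt (2 * pi) / a) ^ DIM('a) * exp (- (norm z / a)\<^sup>2 / 2)))"
proof -
  have nrm: "(norm x)\<^sup>2 = (\<Sum>b\<in>Basis. (x \<bullet> b)\<^sup>2)" for x :: 'a
    unfolding power2_norm_eq_inner by (subst euclidean_inner) (simp add: power2_eq_square)
  have cis_sum: "cis (sum g A) = (\<Prod>b\<in>A. cis (g b))" if "finite A" for g and A :: "'a set"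
    using that by induction (auto simp flip: cis_mult)
  have 1: "complex_of_real (exp (- (a * norm x)\<^sup>2 / 2)) * cis (x \<bullet> z) =
     (\<Prod>b\<in>Basis. complex_of_real (exp (- (a * (x \<bullet> b))\<^sup>2 / 2)) * cis ((x \<bullet> b) * (z \<bullet> b)))" for x :: 'a
  proof -
    have "- (a * norm x)\<^sup>2 / 2 = (\<Sum>b\<in>Basis. - (a * (x \<bullet> b))\<^sup>2 / 2)"
      by (simp add: power_mult_distrib nrm sum_distrib_left sum_negf sum_divide_distrib)
    moreover have "cis (x \<bullet> z) = (\<Prod>b\<in>Basis. cis ((x \<bullet> b) * (z \<bullet> b)))"
      by (subst euclidean_inner) (simp add: cis_sum)
    ultimately show ?thesis
      by (simp add: exp_sum prod.distrib)
  qed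
  have 2: "(sqrt (2 * pi) / a) ^ DIM('a) * exp (- (norm z / a)\<^sup>2 / 2) =
     (\<Prod>b\<in>Basis. sqrt (2 * pi) / a * exp (- ((z \<bullet> b) / a)\<^sup>2 / 2))"
  proof -
    have "- (norm z / a)\<^sup>2 / 2 = (\<Sum>b\<in>Basis. - ((z \<bullet> b) / a)\<^sup>2 / 2)"
      by (simp add: power_divide nrm sum_negf sum_divide_distrib)
    then show ?thesis
      by (simp add: exp_sum prod.distrib prod_dividef power_divide)
  qed
  show ?thesis
    unfolding 1 2 of_real_prod
    by (rule has_bochner_integral_lborel_prod) (rule has_bochner_integral_gaussian_cis[OF a])
qed

lemma nn_integral_gaussian_euclidean:
  assumes a: "a > 0"
  shows "(\<integral>\<^sup>+x. ennreal (exp (- (a * norm (x::'a::euclidean_space))\<^sup>2 / 2)) \<partial>lborel) =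
     ennreal ((sqrt (2 * pi) / a) ^ DIM('a))"
proof -
  have "has_bochner_integral lborel (\<lambda>x::'a. complex_of_real (exp (- (a * norm x)\<^sup>2 / 2)))
           (complex_of_real ((sqrt (2 * pi) / a) ^ DIM('a)))"
    using has_bochner_integral_gaussian_cis_euclidean[OF a, of 0] by simp
  then have "has_bochner_integral lborel (\<lambda>x::'a. exp (- (a * norm x)\<^sup>2 / 2))
           ((sqrt (2 * pi) / a) ^ DIM('a))"
    using has_bochner_integral_Re by fastforce
  then show ?thesis
    by (simp add: has_bochner_integral_iff nn_integral_eq_integral)
qed

section \<open>Fourier integrals of integrable functions; affine changes of variable\<close>

lemma borel_measurable_cnj [measurable]: "cnj \<in> borel_measurable borel"
  by (intro borel_measurable_continuous_onI continuous_intros)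

lemma fourier_int_lborel:
  assumes [measurable]: "f \<in> borel_measurable borel"
  shows "fourier_int s f \<xi> = (\<integral>x. f x * cis (s * 2 * pi * (x \<bullet> \<xi>)) \<partial>lborel)"
  unfolding fourier_int_def cis_conv_exp
  by (rule integral_completion) simp

lemma integrable_mult_cis:
  fixes f :: "'a \<Rightarrow> complex"
  assumes f: "integrable M f" and [measurable]: "g \<in> borel_measurable M"
  shows "integrable M (\<lambda>x. f x * cis (g x))"
proof -
  note [measurable] = borel_measurable_integrable[OF f]
  show ?thesis unfolding cis_conv_exp
  by (rule Bochner_Integration.integrable_bound[OF f]) (auto simp: norm_mult )
qed

lemma norm_fourier_int_le: "norm (fourier_int s f \<xi>) \<le> (\<integral>x. norm (f x) \<partial>lebesgue)"
proof -
  have "norm (fourier_int s f \<xi>) \<le> (\<integral>x. norm (f x * cis (s * 2 * pi * (x \<bullet> \<xi>))) \<partial>lebesgue)"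
    unfolding fourier_int_def by (rule integral_norm_bound)
  then show ?thesis by (simp add: norm_mult)
qed

lemma measurable_fourier_int [measurable]:
  assumes [measurable]: "f \<in> borel_measurable borel"
  shows "fourier_int s f \<in> borel_measurable borel"
proof -
  have "(\<lambda>\<xi>. \<integral>x. f x * cis (s * 2 * pi * (x \<bullet> \<xi>)) \<partial>lborel) \<in> borel_measurable borel"
    unfolding cis_conv_exp by measurable
  then show ?thesis
    by (simp add: fourier_int_lborel cong: measurable_cong)
qed

text \<open>The multiplication formula: the kernel is symmetric in the two variables, so both sides
  are iterated integrals of one integrable function on the product space. The sign \<open>s\<close>
  is the same on both sides.\<close>

lemma integral_fourier_int_mult:
  fixes f g :: "'a::euclidean_space \<Rightarrow> complex"
  assumes f: "integrable lborel f" and g: "integrable lborel g"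
  shows "(\<integral>\<xi>. fourier_int s f \<xi> * g \<xi> \<partial>lborel) = (\<integral>x. f x * fourier_int s g x \<partial>lborel)"
proof -
  have [measurable]: "f \<in> borel_measurable borel" "g \<in> borel_measurable borel"
    using f g by (auto dest: borel_measurable_integrable)
  have "integrable (lborel \<Otimes>\<^sub>M lborel) (\<lambda>p. f (fst p) * g (snd p))"
  proof (rule lborel_pair.Fubini_integrable)
    show "integrable lborel (\<lambda>x. \<integral>y. norm (f (fst (x, y)) * g (snd (x, y))) \<partial>lborel)"
      using f by (simp add: norm_mult)
    show "AE x in lborel. integrable lborel (\<lambda>y. f (fst (x, y)) * g (snd (x, y)))"
      using g by simp
  qed measurable
  \<comment> \<open>The character has modulus one, so integrability passes from the tensor product
    to the full integrand.\<close>
  then have "integrable (lborel \<Otimes>\<^sub>M lborel) (\<lambda>p. f (fst p) * g (snd p) * cis (s * 2 * pi * (fst p \<bullet> snd p)))"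
    by (rule integrable_mult_cis) measurable
  then have "(\<integral>y. (\<integral>x. f x * g y * cis (s * 2 * pi * (x \<bullet> y)) \<partial>lborel) \<partial>lborel) =
    (\<integral>x. (\<integral>y. f x * g y * cis (s * 2 * pi * (x \<bullet> y)) \<partial>lborel) \<partial>lborel)"
    by (intro lborel_pair.Fubini_integral) (simp add: case_prod_beta')
  moreover have "(\<integral>x. f x * g y * cis (s * 2 * pi * (x \<bullet> y)) \<partial>lborel) = fourier_int s f y * g y" for y
    unfolding fourier_int_lborel[OF \<open>f \<in> _\<close>] integral_mult_left_zero[symmetric] by (simp add: mult_ac)
  moreover have "(\<integral>y. f x * g y * cis (s * 2 * pi * (x \<bullet> y)) \<partial>lborel) = f x * fourier_int s g x" for x
    unfolding fourier_int_lborel[OF \<open>g \<in> _\<close>] integral_mult_right_zero[symmetric] by (simp add: mult_ac inner_commute)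
  ultimately show ?thesis by simp
qed

text \<open>For a non-integrable function the Bochner integral takes its default value 0, and the
  bound is trivial.\<close>

lemma ennreal_norm_integral_le:
  fixes f :: "'a \<Rightarrow> 'b::{banach, second_countable_topology}"
  shows "ennreal (norm (integral\<^sup>L M f)) \<le> (\<integral>\<^sup>+x. ennreal (norm (f x)) \<partial>M)"
  by (cases "integrable M f") (auto simp: integral_norm_bound_ennreal not_integrable_integral_eq)

lemma nn_integral_lborel_affine:
  fixes f :: "'a::euclidean_space \<Rightarrow> ennreal"
  assumes [measurable]: "f \<in> borel_measurable borel" and c: "c \<noteq> 0"
  shows "(\<integral>\<^sup>+x. f x \<partial>lborel) = ennreal (\<bar>c\<bar> ^ DIM('a)) * (\<integral>\<^sup>+x. f (t + c *\<^sub>R x) \<partial>lborel)"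
  by (subst lborel_affine[OF c, of t])
     (simp add: nn_integral_density nn_integral_distr nn_integral_cmult)

lemma nn_integral_lborel_translate:
  fixes f :: "'a::euclidean_space \<Rightarrow> ennreal"
  assumes [measurable]: "f \<in> borel_measurable borel"
  shows "(\<integral>\<^sup>+x. f (x - t) \<partial>lborel) = (\<integral>\<^sup>+x. f x \<partial>lborel)"
  using nn_integral_lborel_affine[of f 1 "- t"] by simp

lemma nn_integral_lborel_reflect:
  fixes f :: "'a::euclidean_space \<Rightarrow> ennreal"
  assumes [measurable]: "f \<in> borel_measurable borel"
  shows "(\<integral>\<^sup>+x. f (t - x) \<partial>lborel) = (\<integral>\<^sup>+x. f x \<partial>lborel)"
  using nn_integral_lborel_affine[of f "-1" t] by simp

section \<open>Gaussian kernels of unit mass and the damped Plancherel bound\<close>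

lemma fourier_int_gaussian:
  fixes z :: "'a::euclidean_space"
  assumes e: "e > 0" and s: "\<bar>s\<bar> = 1"
  shows "(\<integral>\<xi>. complex_of_real (exp (- (e * norm \<xi>)\<^sup>2 / 2)) * cis (s * 2 * pi * (\<xi> \<bullet> z)) \<partial>lborel) =
    complex_of_real ((sqrt (2 * pi) / e) ^ DIM('a) * exp (- (2 * pi / e * norm z)\<^sup>2 / 2))"
  using has_bochner_integral_gaussian_cis_euclidean[OF e, of "(s * 2 * pi) *\<^sub>R z"] s
  by (simp add: has_bochner_integral_iff abs_mult mult_ac)

text \<open>The kernel dual to the Gaussian damping averages, and its unit mass is what gives the
  Plancherel bound the constant 1. The \<open>2 * pi\<close> in the exponent of the transform is
  responsible for this normalisation.\<close>

lemma nn_integral_fourier_gaussian: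
  assumes e: "e > 0"
  shows "(\<integral>\<^sup>+z. ennreal ((sqrt (2 * pi) / e) ^ DIM('a) * exp (- (2 * pi / e * norm (z::'a::euclidean_space))\<^sup>2 / 2)) \<partial>lborel) = 1"
proof -
  have "(sqrt (2 * pi) / e) * (sqrt (2 * pi) / (2 * pi / e)) = 1"
    using e by (simp add: field_simps)
  then have "ennreal ((sqrt (2 * pi) / e) ^ DIM('a)) * ennreal ((sqrt (2 * pi) / (2 * pi / e)) ^ DIM('a)) = 1"
    using e by (simp flip: ennreal_mult power_mult_distrib)
  then show ?thesis
    using e nn_integral_gaussian_euclidean[of "2 * pi / e", where 'a='a]
    by (simp add: ennreal_mult nn_integral_cmult)
qed

text \<open>Writing |A|^2 as A times its conjugate and applying the multiplication formula twice
  turns the damped integral into a double integral of f(x), the conjugate of f(y), and W(x - y). As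
  \<open>W\<close> is nonnegative with mass one, the inequality between arithmetic and geometric
  mean bounds it by the integral of |f|^2.\<close>

lemma nn_integral_gaussian_fourier_int_le:
  fixes f :: "'a::euclidean_space \<Rightarrow> complex"
  assumes f: "integrable lborel f" and s: "\<bar>s\<bar> = 1" and e: "e > 0"
  shows "(\<integral>\<^sup>+\<xi>. ennreal (exp (- (e * norm \<xi>)\<^sup>2 / 2) * (cmod (fourier_int s f \<xi>))\<^sup>2) \<partial>lborel)
     \<le> (\<integral>\<^sup>+x. ennreal ((cmod (f x))\<^sup>2) \<partial>lborel)"
proof -
  note [measurable] = borel_measurable_integrable[OF f, simplified]
  define w where "w \<xi> = exp (- (e * norm \<xi>)\<^sup>2 / 2)" for \<xi> :: 'a
  define W where "W z = (sqrt (2 * pi) / e) ^ DIM('a) * exp (- (2 * pi / e * norm z)\<^sup>2 / 2)" for z :: 'a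
  define A where "A = fourier_int s f"
  have [measurable]: "A \<in> borel_measurable borel" "w \<in> borel_measurable borel" "W \<in> borel_measurable borel"
    unfolding A_def w_def[abs_def] W_def[abs_def] by measurable
  have W0: "W z \<ge> 0" for z unfolding W_def using e by simp
  have W1: "(\<integral>\<^sup>+z. ennreal (W z) \<partial>lborel) = 1"
    unfolding W_def by (rule nn_integral_fourier_gaussian[OF e])
  have w0: "w \<xi> \<ge> 0" for \<xi> unfolding w_def by simp
  have iw: "integrable lborel w"
    using has_bochner_integral_gaussian_cis_euclidean[OF e, of "0::'a"] has_bochner_integral_Re
    unfolding w_def[abs_def] by (fastforce simp: has_bochner_integral_iff)
  obtain K where K: "\<And>\<xi>. norm (A \<xi>) \<le> K"
    unfolding A_def using norm_fourier_int_le by blast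
  have K0: "K \<ge> 0" using K[of 0] norm_ge_zero order_trans by blast
  \<comment> \<open>Here the damping enters: \<open>A\<close> is only known to be bounded, while the
    multiplication formula asks for an integrable factor.\<close>
  have iwA: "integrable lborel (\<lambda>\<xi>. complex_of_real (w \<xi>) * cnj (A \<xi>))"
    by (rule Bochner_Integration.integrable_bound[OF integrable_mult_left[OF iw, of K]])
       (auto simp: norm_mult abs_mult w0 K0 intro!: mult_left_mono K)
  have cnjA: "cnj (A \<xi>) = fourier_int (- s) (\<lambda>y. cnj (f y)) \<xi>" for \<xi>
    unfolding A_def fourier_int_def
    by (subst Bochner_Integration.integral_cnj[symmetric]) (simp add: cis_cnj)
  \<comment> \<open>Second use of the multiplication formula: \<open>g\<close> is the damping
    modulated by a character, and its transform is the Gaussian \<open>W\<close> translated to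
    \<open>x\<close>.\<close>
  have inner: "fourier_int s (\<lambda>\<xi>. complex_of_real (w \<xi>) * cnj (A \<xi>)) x
      = (\<integral>y. cnj (f y) * complex_of_real (W (x - y)) \<partial>lborel)" for x
  proof -
    define g where "g \<xi> = complex_of_real (w \<xi>) * cis (s * 2 * pi * (\<xi> \<bullet> x))" for \<xi>
    have ig: "integrable lborel g"
      unfolding g_def[abs_def] by (rule integrable_mult_cis) (use iw in auto)
    note [measurable] = borel_measurable_integrable[OF ig, simplified]
    have g: "fourier_int (- s) g y = complex_of_real (W (x - y))" for y
    proof -
      have "fourier_int (- s) g y = (\<integral>\<xi>. complex_of_real (w \<xi>) * cis (s * 2 * pi * (\<xi> \<bullet> (x - y))) \<partial>lborel)"
        by (simp add: fourier_int_lborel g_def mult.assoc cis_mult inner_diff_right right_diff_distrib del: mult_minus_left)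
      then show ?thesis
        unfolding w_def W_def fourier_int_gaussian[OF e s] .
    qed
    have "fourier_int s (\<lambda>\<xi>. complex_of_real (w \<xi>) * cnj (A \<xi>)) x = (\<integral>\<xi>. cnj (A \<xi>) * g \<xi> \<partial>lborel)"
      by (subst fourier_int_lborel) (auto simp: g_def mult_ac)
    also have "\<dots> = (\<integral>y. cnj (f y) * fourier_int (- s) g y \<partial>lborel)"
      unfolding cnjA by (rule integral_fourier_int_mult) (use f ig in auto)
    finally show ?thesis unfolding g .
  qed
  have "complex_of_real (\<integral>\<xi>. w \<xi> * (cmod (A \<xi>))\<^sup>2 \<partial>lborel) = (\<integral>\<xi>. A \<xi> * (complex_of_real (w \<xi>) * cnj (A \<xi>)) \<partial>lborel)"
    unfolding integral_complex_of_real[symmetric] of_real_mult complex_norm_square by (simp add: mult_ac)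
  also have "\<dots> = (\<integral>x. f x * (\<integral>y. cnj (f y) * complex_of_real (W (x - y)) \<partial>lborel) \<partial>lborel)"
    using integral_fourier_int_mult[OF f iwA, of s] by (simp add: A_def[symmetric] inner)
  finally have eq: "complex_of_real (\<integral>\<xi>. w \<xi> * (cmod (A \<xi>))\<^sup>2 \<partial>lborel) = \<dots>" .
  have iwA2: "integrable lborel (\<lambda>\<xi>. w \<xi> * (cmod (A \<xi>))\<^sup>2)"
    by (rule Bochner_Integration.integrable_bound[OF integrable_mult_left[OF iw, of "K\<^sup>2"]])
       (auto simp: norm_mult abs_mult w0 K0 intro!: mult_left_mono power_mono K)
  have "(\<integral>\<^sup>+\<xi>. ennreal (w \<xi> * (cmod (A \<xi>))\<^sup>2) \<partial>lborel) = ennreal (\<integral>\<xi>. w \<xi> * (cmod (A \<xi>))\<^sup>2 \<partial>lborel)"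
    by (rule nn_integral_eq_integral[OF iwA2]) (simp add: w0)
  also have "\<dots> \<le> ennreal (norm (complex_of_real (\<integral>\<xi>. w \<xi> * (cmod (A \<xi>))\<^sup>2 \<partial>lborel)))"
    by (intro ennreal_leI) simp
  also have "\<dots> \<le> (\<integral>\<^sup>+x. ennreal (cmod (f x)) * ennreal (norm (\<integral>y. cnj (f y) * complex_of_real (W (x - y)) \<partial>lborel)) \<partial>lborel)"
    unfolding eq by (rule order_trans[OF ennreal_norm_integral_le]) (simp add: norm_mult ennreal_mult)
  also have "\<dots> \<le> (\<integral>\<^sup>+x. ennreal (cmod (f x)) * (\<integral>\<^sup>+y. ennreal (cmod (f y) * W (x - y)) \<partial>lborel) \<partial>lborel)"
    using ennreal_norm_integral_le[of lborel "\<lambda>y. cnj (f y) * complex_of_real (W (x - y))" for x]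
    by (intro nn_integral_mono mult_left_mono) (simp_all add: norm_mult W0)
  also have "\<dots> = (\<integral>\<^sup>+x. (\<integral>\<^sup>+y. ennreal (cmod (f x)) * ennreal (cmod (f y) * W (x - y)) \<partial>lborel) \<partial>lborel)"
    by (simp add: nn_integral_cmult)
  \<comment> \<open>Replacing |f(x)| |f(y)| by half the sum of the squares decouples the variables,
    so that each term contains only one value of f and the kernel.\<close>
  also have "\<dots> \<le> (\<integral>\<^sup>+x. (\<integral>\<^sup>+y. ennreal ((cmod (f x))\<^sup>2 / 2) * ennreal (W (x - y)) + ennreal ((cmod (f y))\<^sup>2 / 2) * ennreal (W (x - y)) \<partial>lborel) \<partial>lborel)"
  proof (intro nn_integral_mono)
    fix x y
    have "cmod (f x) * cmod (f y) \<le> (cmod (f x))\<^sup>2 / 2 + (cmod (f y))\<^sup>2 / 2"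
      using sum_squares_bound[of "cmod (f x)" "cmod (f y)"] by simp
    then have "cmod (f x) * cmod (f y) * W (x - y) \<le> ((cmod (f x))\<^sup>2 / 2 + (cmod (f y))\<^sup>2 / 2) * W (x - y)"
      by (rule mult_right_mono[OF _ W0])
    then show "ennreal (cmod (f x)) * ennreal (cmod (f y) * W (x - y)) \<le>
       ennreal ((cmod (f x))\<^sup>2 / 2) * ennreal (W (x - y)) + ennreal ((cmod (f y))\<^sup>2 / 2) * ennreal (W (x - y))"
      by (simp add: W0 mult_ac distrib_left ennreal_leI flip: ennreal_mult ennreal_plus)
  qed
  also have "\<dots> = (\<integral>\<^sup>+x. (\<integral>\<^sup>+y. ennreal ((cmod (f x))\<^sup>2 / 2) * ennreal (W (x - y)) \<partial>lborel) \<partial>lborel)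
      + (\<integral>\<^sup>+x. (\<integral>\<^sup>+y. ennreal ((cmod (f y))\<^sup>2 / 2) * ennreal (W (x - y)) \<partial>lborel) \<partial>lborel)"
    by (simp add: nn_integral_add)
  \<comment> \<open>After the swap the inner variable occurs in \<open>W\<close> alone, and its
    integral is 1 by translation invariance; in the other term \<open>W\<close> is already
    integrated over \<open>y\<close>, which needs a reflection.\<close>
  also have "(\<integral>\<^sup>+x. (\<integral>\<^sup>+y. ennreal ((cmod (f y))\<^sup>2 / 2) * ennreal (W (x - y)) \<partial>lborel) \<partial>lborel)
     = (\<integral>\<^sup>+y. (\<integral>\<^sup>+x. ennreal ((cmod (f y))\<^sup>2 / 2) * ennreal (W (x - y)) \<partial>lborel) \<partial>lborel)"
    by (rule lborel_pair.Fubini') measurable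
  also have "\<dots> = (\<integral>\<^sup>+y. ennreal ((cmod (f y))\<^sup>2 / 2) \<partial>lborel)"
    by (simp add: nn_integral_cmult nn_integral_lborel_translate[of "\<lambda>z. ennreal (W z)"] W1)
  also have "(\<integral>\<^sup>+x. (\<integral>\<^sup>+y. ennreal ((cmod (f x))\<^sup>2 / 2) * ennreal (W (x - y)) \<partial>lborel) \<partial>lborel) = (\<integral>\<^sup>+y. ennreal ((cmod (f y))\<^sup>2 / 2) \<partial>lborel)"
    by (simp add: nn_integral_cmult nn_integral_lborel_reflect[of "\<lambda>z. ennreal (W z)"] W1)
  also have "(\<integral>\<^sup>+y. ennreal ((cmod (f y))\<^sup>2 / 2) \<partial>lborel) + (\<integral>\<^sup>+y. ennreal ((cmod (f y))\<^sup>2 / 2) \<partial>lborel)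
     = (\<integral>\<^sup>+x. ennreal ((cmod (f x))\<^sup>2) \<partial>lborel)"
    by (subst nn_integral_add[symmetric]) (auto simp flip: ennreal_plus)
  finally show ?thesis
    unfolding w_def A_def .
qed

lemma nn_integral_fourier_int_le:
  fixes f :: "'a::euclidean_space \<Rightarrow> complex"
  assumes f: "integrable lborel f" and s: "\<bar>s\<bar> = 1"
  shows "(\<integral>\<^sup>+\<xi>. ennreal ((cmod (fourier_int s f \<xi>))\<^sup>2) \<partial>lborel) \<le> (\<integral>\<^sup>+x. ennreal ((cmod (f x))\<^sup>2) \<partial>lborel)"
proof -
  note [measurable] = borel_measurable_integrable[OF f, simplified]
  define u where "u n \<xi> = ennreal (exp (- (inverse (real (Suc n)) * norm \<xi>)\<^sup>2 / 2) * (cmod (fourier_int s f \<xi>))\<^sup>2)" for n \<xi>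
  have [measurable]: "u n \<in> borel_measurable borel" for n
    unfolding u_def[abs_def] by measurable
  have "(\<lambda>n. u n \<xi>) \<longlonglongrightarrow> ennreal ((cmod (fourier_int s f \<xi>))\<^sup>2)" for \<xi>
  proof -
    have "(\<lambda>n. exp (- (inverse (real (Suc n)) * norm \<xi>)\<^sup>2 / 2) * (cmod (fourier_int s f \<xi>))\<^sup>2)
       \<longlonglongrightarrow> exp (- (0 * norm \<xi>)\<^sup>2 / 2) * (cmod (fourier_int s f \<xi>))\<^sup>2"
      by (intro tendsto_intros LIMSEQ_inverse_real_of_nat) simp
    then show ?thesis unfolding u_def by (intro tendsto_ennrealI) simp
  qed
  then have "(\<integral>\<^sup>+\<xi>. ennreal ((cmod (fourier_int s f \<xi>))\<^sup>2) \<partial>lborel) = (\<integral>\<^sup>+\<xi>. liminf (\<lambda>n. u n \<xi>) \<partial>lborel)"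
    by (intro nn_integral_cong) (metis lim_imp_Liminf sequentially_bot)
  also have "\<dots> \<le> liminf (\<lambda>n. \<integral>\<^sup>+\<xi>. u n \<xi> \<partial>lborel)"
    by (rule nn_integral_liminf) measurable
  also have "\<dots> \<le> liminf (\<lambda>n. \<integral>\<^sup>+x. ennreal ((cmod (f x))\<^sup>2) \<partial>lborel)"
    unfolding u_def by (intro Liminf_mono always_eventually allI nn_integral_gaussian_fourier_int_le f s) simp
  finally show ?thesis by (simp add: Liminf_const)
qed

subsection \<open>The Fourier transform on \<open>L\<^sup>2\<close>\<close>

text \<open>The squared norm takes values in \<open>ennreal\<close>, so it makes sense for every
  function, and limits and comparisons carry no integrability side conditions.\<close>

definition L2sq :: "('a::euclidean_space \<Rightarrow> complex) \<Rightarrow> ennreal" where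
  "L2sq f = (\<integral>\<^sup>+x. ennreal ((cmod (f x))\<^sup>2) \<partial>lebesgue)"

lemma L2sq_lborel: "L2sq f = (\<integral>\<^sup>+x. ennreal ((cmod (f x))\<^sup>2) \<partial>lborel)"
  unfolding L2sq_def by (rule nn_integral_completion)

lemma borel_imp_lebesgue_measurable:
  "f \<in> borel_measurable borel \<Longrightarrow> f \<in> borel_measurable lebesgue"
  by (rule measurable_completion) simp

lemma square_integrable_iff_L2sq:
  "square_integrable f \<longleftrightarrow> f \<in> borel_measurable lebesgue \<and> L2sq f < \<infinity>"
proof -
  have "integrable lebesgue (\<lambda>x. (cmod (f x))\<^sup>2) \<longleftrightarrow> L2sq f < \<infinity>" if [measurable]: "f \<in> borel_measurable lebesgue"
    unfolding integrable_iff_bounded L2sq_def by simp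
  then show ?thesis unfolding square_integrable_def by auto
qed

lemma L2sq_cong_AE: "AE x in lebesgue. f x = g x \<Longrightarrow> L2sq f = L2sq g"
  unfolding L2sq_def by (rule nn_integral_cong_AE) auto

lemma L2sq_mono: "(\<And>x. cmod (f x) \<le> cmod (g x)) \<Longrightarrow> L2sq f \<le> L2sq g"
  unfolding L2sq_def by (intro nn_integral_mono ennreal_leI power_mono) auto

text \<open>Squared norms avoid square roots; the price is the factor 2 from (a + b)^2 \<le> 2 a^2 +
  2 b^2.\<close>

lemma L2sq_triangle:
  assumes [measurable]: "f \<in> borel_measurable lebesgue" "g \<in> borel_measurable lebesgue" "h \<in> borel_measurable lebesgue"
  shows "L2sq (\<lambda>x. f x - h x) \<le> 2 * L2sq (\<lambda>x. f x - g x) + 2 * L2sq (\<lambda>x. g x - h x)"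
proof -
  have "L2sq (\<lambda>x. f x - h x) \<le> (\<integral>\<^sup>+x. 2 * ennreal ((cmod (f x - g x))\<^sup>2) + 2 * ennreal ((cmod (g x - h x))\<^sup>2) \<partial>lebesgue)"
    unfolding L2sq_def
  proof (intro nn_integral_mono)
    fix x
    let ?a = "cmod (f x - g x)" and ?b = "cmod (g x - h x)"
    have "(cmod (f x - h x))\<^sup>2 \<le> (?a + ?b)\<^sup>2"
      by (rule power_mono) (use norm_triangle_ineq[of "f x - g x" "g x - h x"] in auto)
    also have "\<dots> \<le> 2 * ?a\<^sup>2 + 2 * ?b\<^sup>2"
      using sum_squares_bound[of ?a ?b] by (simp add: power2_sum)
    finally have "ennreal ((cmod (f x - h x))\<^sup>2) \<le> ennreal (2 * ?a\<^sup>2 + 2 * ?b\<^sup>2)"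
      by (rule ennreal_leI)
    then show "ennreal ((cmod (f x - h x))\<^sup>2) \<le> 2 * ennreal (?a\<^sup>2) + 2 * ennreal (?b\<^sup>2)"
      by (simp add: ennreal_mult)
  qed
  also have "\<dots> = 2 * L2sq (\<lambda>x. f x - g x) + 2 * L2sq (\<lambda>x. g x - h x)"
    unfolding L2sq_def by (simp add: nn_integral_add nn_integral_cmult)
  finally show ?thesis .
qed

text \<open>Each weighted term is at most the whole sum \<open>M\<close>, so the n-th increment is
  at most a constant times 2^(-n), and the telescoping series converges absolutely.\<close>

lemma convergent_of_geometric_increments:
  fixes a :: "nat \<Rightarrow> complex"
  assumes fin: "(\<Sum>n. ennreal (4 ^ n * (cmod (a n - a (Suc n)))\<^sup>2)) \<noteq> \<infinity>"
  shows "convergent a"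
proof -
  define b where "b n = ennreal (4 ^ n * (cmod (a n - a (Suc n)))\<^sup>2)" for n
  define S where "S = (\<Sum>n. b n)"
  have "S \<noteq> \<infinity>" using fin unfolding S_def b_def .
  then obtain M where M: "M \<ge> 0" "S = ennreal M"
    by (cases S) auto
  have incr: "cmod (a (Suc n) - a n) \<le> (1 + M) * (1 / 2) ^ n" for n
  proof -
    have "b n \<le> ennreal M"
      unfolding M(2)[symmetric] S_def using sum_le_suminf[of b "{n}"] by simp
    then have "4 ^ n * (cmod (a n - a (Suc n)))\<^sup>2 \<le> M"
      using M(1) by (simp add: b_def)
    \<comment> \<open>\<open>1 + M\<close> stands in for the square root of \<open>M\<close>, so
      that both sides are squares.\<close>
    also have "M \<le> (1 + M)\<^sup>2"
      using M(1) by (simp add: power2_eq_square algebra_simps)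
    also have "4 ^ n * (cmod (a n - a (Suc n)))\<^sup>2 = (2 ^ n * cmod (a n - a (Suc n)))\<^sup>2"
    proof -
      have "(4::real) ^ n = (2 ^ n)\<^sup>2"
        using power_mult[of "2::real" 2 n] power_mult[of "2::real" n 2] by (simp add: mult.commute)
      then show ?thesis by (simp add: power_mult_distrib)
    qed
    finally have "2 ^ n * cmod (a n - a (Suc n)) \<le> 1 + M"
      by (rule power2_le_imp_le) (use M(1) in simp)
    then have "cmod (a n - a (Suc n)) \<le> (1 + M) * (1 / 2) ^ n"
      by (simp add: field_simps power_one_over)
    then show ?thesis by (subst norm_minus_commute)
  qed
  have "summable (\<lambda>n. (1 + M) * (1 / 2) ^ n)"
    by (intro summable_mult summable_geometric) simp
  then have "summable (\<lambda>n. a (Suc n) - a n)"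
    by (rule summable_comparison_test'[where N = 0]) (rule incr)
  then have "convergent (\<lambda>n. a n - a 0)"
    by (simp add: summable_iff_convergent sum_lessThan_telescope)
  then show ?thesis
    by (simp add: convergent_diff_const_right_iff)
qed

text \<open>The rate \<open>8\<^sup>-\<^sup>m\<close> leaves room for the weights \<open>4\<^sup>m\<close>, which turn square
  summability of the increments into pointwise geometric decay.\<close>

lemma L2_complete_geometric:
  fixes G :: "nat \<Rightarrow> 'a::euclidean_space \<Rightarrow> complex"
  assumes [measurable]: "\<And>n. G n \<in> borel_measurable lebesgue"
    and cauchy: "\<And>m n. m \<le> n \<Longrightarrow> L2sq (\<lambda>x. G m x - G n x) \<le> ennreal ((1 / 8) ^ m)"
  shows "\<exists>g\<in>borel_measurable lebesgue. \<forall>m. L2sq (\<lambda>x. G m x - g x) \<le> ennreal ((1 / 8) ^ m)"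
proof -
  \<comment> \<open>Where the sequence diverges, \<open>lim\<close> has an unspecified value; that
    set turns out to be null, and \<open>lim\<close> keeps \<open>g\<close> measurable
    everywhere.\<close>
  define g where "g x = lim (\<lambda>n. G n x)" for x
  have [measurable]: "g \<in> borel_measurable lebesgue"
    unfolding g_def[abs_def] by measurable
  have "(\<integral>\<^sup>+x. (\<Sum>n. ennreal (4 ^ n * (cmod (G n x - G (Suc n) x))\<^sup>2)) \<partial>lebesgue)
      = (\<Sum>n. ennreal (4 ^ n) * L2sq (\<lambda>x. G n x - G (Suc n) x))"
    by (simp add: nn_integral_suminf L2sq_def ennreal_mult nn_integral_cmult)
  also have "\<dots> \<le> (\<Sum>n. ennreal ((1 / 2) ^ n))"
  proof (intro suminf_le summableI)
    fix n
    have "ennreal (4 ^ n) * L2sq (\<lambda>x. G n x - G (Suc n) x) \<le> ennreal (4 ^ n) * ennreal ((1 / 8) ^ n)"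
      by (intro mult_left_mono cauchy) auto
    also have "\<dots> = ennreal ((1 / 2) ^ n)"
      by (simp flip: ennreal_mult power_mult_distrib)
    finally show "ennreal (4 ^ n) * L2sq (\<lambda>x. G n x - G (Suc n) x) \<le> ennreal ((1 / 2) ^ n)" .
  qed
  also have "\<dots> = ennreal (\<Sum>n. (1 / 2) ^ n)"
    by (rule suminf_ennreal2) (auto intro: summable_geometric)
  finally have "(\<integral>\<^sup>+x. (\<Sum>n. ennreal (4 ^ n * (cmod (G n x - G (Suc n) x))\<^sup>2)) \<partial>lebesgue) \<noteq> \<infinity>"
    by (metis ennreal_less_top infinity_ennreal_def leD)
  then have "AE x in lebesgue. (\<Sum>n. ennreal (4 ^ n * (cmod (G n x - G (Suc n) x))\<^sup>2)) \<noteq> \<infinity>"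
    by (intro nn_integral_PInf_AE) measurable
  then have lim: "AE x in lebesgue. (\<lambda>n. G n x) \<longlonglongrightarrow> g x"
    by eventually_elim (simp add: g_def convergent_LIMSEQ_iff[symmetric] convergent_of_geometric_increments)
  have "L2sq (\<lambda>x. G m x - g x) \<le> ennreal ((1 / 8) ^ m)" for m
  proof -
    \<comment> \<open>Fatou in the second index passes the Cauchy estimate to the limit with the
      same rate.\<close>
    have "L2sq (\<lambda>x. G m x - g x) = (\<integral>\<^sup>+x. liminf (\<lambda>n. ennreal ((cmod (G m x - G n x))\<^sup>2)) \<partial>lebesgue)"
      unfolding L2sq_def
    proof (rule nn_integral_cong_AE, use lim in eventually_elim)
      case (elim x)
      then have "(\<lambda>n. ennreal ((cmod (G m x - G n x))\<^sup>2)) \<longlonglongrightarrow> ennreal ((cmod (G m x - g x))\<^sup>2)"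
        by (intro tendsto_intros)
      then show ?case by (rule lim_imp_Liminf[OF sequentially_bot, symmetric])
    qed
    also have "\<dots> \<le> liminf (\<lambda>n. L2sq (\<lambda>x. G m x - G n x))"
      unfolding L2sq_def by (rule nn_integral_liminf) measurable
    also have "\<dots> \<le> liminf (\<lambda>n. ennreal ((1 / 8) ^ m))"
      by (intro Liminf_mono eventually_sequentiallyI[of m] cauchy)
    finally show ?thesis by (simp add: Liminf_const)
  qed
  then show ?thesis by (intro bexI[of _ g]) auto
qed

text \<open>Real and imaginary parts are modified separately on null sets. This is the bridge from
  \<open>lebesgue\<close> to Borel functions on \<open>lborel\<close>.\<close>

lemma lebesgue_measurable_ex_borel:
  fixes f :: "'a::euclidean_space \<Rightarrow> complex"
  assumes f [measurable]: "f \<in> borel_measurable lebesgue"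
  shows "\<exists>g\<in>borel_measurable borel. AE x in lebesgue. f x = g x"
proof -
  have meas: "(\<lambda>x. Re (f x)) \<in> borel_measurable lebesgue" "(\<lambda>x. Im (f x)) \<in> borel_measurable lebesgue"
    by measurable
  obtain r where [measurable]: "r \<in> borel_measurable lborel" and r: "AE x in lborel. Re (f x) = r x"
    using completion_ex_borel_measurable_real[OF meas(1)] by blast
  obtain i where [measurable]: "i \<in> borel_measurable lborel" and i: "AE x in lborel. Im (f x) = i x"
    using completion_ex_borel_measurable_real[OF meas(2)] by blast
  have "AE x in lborel. f x = Complex (r x) (i x)"
    using r i by eventually_elim (auto simp: complex_eq_iff)
  then have "AE x in lebesgue. f x = Complex (r x) (i x)"
    by (rule AE_completion)
  moreover have "(\<lambda>x. Complex (r x) (i x)) \<in> borel_measurable borel"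
    using \<open>r \<in> _\<close> \<open>i \<in> _\<close> by (simp add: borel_measurable_complex_iff)
  ultimately show ?thesis by (rule bexI)
qed

section \<open>Fourier integrals depend only on the class of the function\<close>

lemma measurable_mult_cis [measurable]:
  "f \<in> borel_measurable M \<Longrightarrow> g \<in> borel_measurable M \<Longrightarrow> (\<lambda>x. f x * cis (g x)) \<in> borel_measurable M"
  using measurable_compose[OF _ borel_measurable_continuous_onI[OF continuous_on_cis[OF continuous_on_id]]]
  by (intro borel_measurable_times) auto

lemma fourier_int_cong_AE:
  assumes [measurable]: "f \<in> borel_measurable lebesgue" "g \<in> borel_measurable lebesgue"
    and ae: "AE x in lebesgue. f x = g x"
  shows "fourier_int s f = fourier_int s g"
proof
  fix \<xi> :: 'a
  have [measurable]: "(\<lambda>x. s * 2 * pi * (x \<bullet> \<xi>)) \<in> borel_measurable lebesgue"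
    by (rule borel_imp_lebesgue_measurable) measurable
  show "fourier_int s f \<xi> = fourier_int s g \<xi>"
    unfolding fourier_int_def by (rule integral_cong_AE) (measurable, use ae in auto)
qed

lemma borel_measurable_fourier_int:
  assumes "f \<in> borel_measurable lebesgue"
  shows "fourier_int s f \<in> borel_measurable borel"
  using lebesgue_measurable_ex_borel[OF assms] fourier_int_cong_AE[OF assms]
  by (metis borel_imp_lebesgue_measurable measurable_fourier_int)

lemma lebesgue_measurable_fourier_int [measurable]:
  "f \<in> borel_measurable lebesgue \<Longrightarrow> fourier_int s f \<in> borel_measurable lebesgue"
  by (rule borel_imp_lebesgue_measurable) (rule borel_measurable_fourier_int)

lemma L2sq_fourier_int_le:
  assumes f: "integrable lebesgue f" and s: "\<bar>s\<bar> = 1"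
  shows "L2sq (fourier_int s f) \<le> L2sq f"
proof -
  have mf: "f \<in> borel_measurable lebesgue" using f by auto
  obtain g where g: "g \<in> borel_measurable borel" and fg: "AE x in lebesgue. f x = g x"
    using lebesgue_measurable_ex_borel[OF mf] by auto
  have "integrable lebesgue g"
    using integrable_cong_AE[OF mf borel_imp_lebesgue_measurable[OF g] fg] f by simp
  then have "integrable lborel g"
    using g by (subst (asm) integrable_completion) auto
  from nn_integral_fourier_int_le[OF this s] show ?thesis
    unfolding fourier_int_cong_AE[OF mf borel_imp_lebesgue_measurable[OF g] fg] L2sq_cong_AE[OF fg]
    unfolding L2sq_lborel .
qed

lemma integrable_fourier_int_integrand:
  fixes f :: "'a::euclidean_space \<Rightarrow> complex"
  assumes "integrable lebesgue f"
  shows "integrable lebesgue (\<lambda>x. f x * cis (s * 2 * pi * (x \<bullet> \<xi>)))"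
  by (rule integrable_mult_cis[OF assms], rule borel_imp_lebesgue_measurable) measurable

lemma fourier_int_diff:
  assumes "integrable lebesgue f" "integrable lebesgue g"
  shows "fourier_int s f \<xi> - fourier_int s g \<xi> = fourier_int s (\<lambda>x. f x - g x) \<xi>"
  unfolding fourier_int_def
  by (subst Bochner_Integration.integral_diff[symmetric])
     (auto intro!: integrable_fourier_int_integrand assms simp: left_diff_distrib)

section \<open>Truncations and the L^2 limit that defines the transform\<close>

definition trunc :: "real \<Rightarrow> ('a::euclidean_space \<Rightarrow> complex) \<Rightarrow> 'a \<Rightarrow> complex" where
  "trunc R f x = indicator (ball 0 R) x * f x"

text \<open>The predicate under the \<open>SOME\<close> of \<open>fourier_L2\<close>, isolated so
  that any candidate can be tested, not only the chosen one.\<close>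

definition has_fourier_L2 :: "real \<Rightarrow> ('a::euclidean_space \<Rightarrow> complex) \<Rightarrow> ('a \<Rightarrow> complex) \<Rightarrow> bool" where
  "has_fourier_L2 s f g \<longleftrightarrow> square_integrable g \<and>
     ((\<lambda>R. L2sq (\<lambda>\<xi>. fourier_int s (trunc R f) \<xi> - g \<xi>)) \<longlongrightarrow> 0) at_top"

lemma fourier_L2_eq_SOME: "fourier_L2 s f = (SOME g. has_fourier_L2 s f g)"
  unfolding fourier_L2_def has_fourier_L2_def L2sq_def trunc_def[abs_def] ..

lemma trunc_measurable [measurable]:
  assumes [measurable]: "f \<in> borel_measurable lebesgue"
  shows "trunc R f \<in> borel_measurable lebesgue"
proof -
  have [measurable]: "(indicator (ball 0 R) :: 'a \<Rightarrow> complex) \<in> borel_measurable lebesgue"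
    by (intro borel_imp_lebesgue_measurable borel_measurable_indicator) simp
  show ?thesis unfolding trunc_def[abs_def] by measurable
qed

text \<open>On a ball, which has finite measure, |f| is dominated by 1 + |f|^2.\<close>

lemma integrable_trunc:
  assumes f: "square_integrable f"
  shows "integrable lebesgue (trunc R f)"
proof -
  have [measurable]: "f \<in> borel_measurable lebesgue" using f by (simp add: square_integrable_def)
  have 1: "integrable lebesgue (indicator (ball (0::'a) R) :: 'a \<Rightarrow> real)"
    using lmeasurable_ball[of "0::'a" R] by (simp add: fmeasurable_def)
  have "integrable lebesgue (\<lambda>x. indicator (ball 0 R) x + (cmod (f x))\<^sup>2)"
    using f 1 by (auto simp: square_integrable_def)
  then show ?thesis
  proof (rule Bochner_Integration.integrable_bound)
    have "cmod (trunc R f x) \<le> indicator (ball 0 R) x + (cmod (f x))\<^sup>2" for x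
    proof -
      have "cmod (f x) \<le> 1 + (cmod (f x))\<^sup>2"
        using sum_squares_bound[of 1 "cmod (f x)"] norm_ge_zero[of "f x"] unfolding power_one by linarith
      then show ?thesis by (simp add: trunc_def norm_mult indicator_def)
    qed
    then show "AE x in lebesgue. norm (trunc R f x) \<le> norm (indicator (ball 0 R) x + (cmod (f x))\<^sup>2)"
      by (intro always_eventually allI) (auto simp: indicator_def)
  qed measurable
qed

lemma L2sq_tail_tendsto_0:
  assumes f: "square_integrable f"
  shows "((\<lambda>R. L2sq (\<lambda>x. f x - trunc R f x)) \<longlongrightarrow> 0) at_top"
proof -
  have [measurable]: "f \<in> borel_measurable lebesgue" using f by (simp add: square_integrable_def)
  have if2: "integrable lebesgue (\<lambda>x. (cmod (f x))\<^sup>2)" using f by (simp add: square_integrable_def)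
  have le: "cmod (f x - trunc R f x) \<le> cmod (f x)" for x R
    by (auto simp: trunc_def indicator_def)
  have "((\<lambda>R. \<integral>x. (cmod (f x - trunc R f x))\<^sup>2 \<partial>lebesgue) \<longlongrightarrow> integral\<^sup>L lebesgue (\<lambda>x::'a. 0)) at_top"
  proof (rule integral_dominated_convergence_at_top[OF _ _ if2])
    show "\<forall>\<^sub>F R in at_top. AE x in lebesgue. norm ((cmod (f x - trunc R f x))\<^sup>2) \<le> (cmod (f x))\<^sup>2"
      by (auto intro!: always_eventually power_mono le)
    show "AE x in lebesgue. ((\<lambda>R. (cmod (f x - trunc R f x))\<^sup>2) \<longlongrightarrow> 0) at_top"
    proof (rule AE_I2, rule tendsto_eventually)
      fix x
      show "\<forall>\<^sub>F R in at_top. (cmod (f x - trunc R f x))\<^sup>2 = 0"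
        using eventually_gt_at_top[of "norm x"] by eventually_elim (simp add: trunc_def)
    qed
  qed measurable
  then have "((\<lambda>R. ennreal (\<integral>x. (cmod (f x - trunc R f x))\<^sup>2 \<partial>lebesgue)) \<longlongrightarrow> ennreal 0) at_top"
    by (intro tendsto_ennrealI) simp
  moreover have "L2sq (\<lambda>x. f x - trunc R f x) = ennreal (\<integral>x. (cmod (f x - trunc R f x))\<^sup>2 \<partial>lebesgue)" for R
    unfolding L2sq_def
    by (rule nn_integral_eq_integral, rule Bochner_Integration.integrable_bound[OF if2])
       (auto intro!: power_mono le)
  ultimately show ?thesis by simp
qed

lemma L2sq_eq_0_imp_AE:
  assumes [measurable]: "f \<in> borel_measurable lebesgue" and "L2sq f = 0"
  shows "AE x in lebesgue. f x = 0"
  using assms(2) unfolding L2sq_def by (subst (asm) nn_integral_0_iff_AE) auto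

text \<open>Both functions are L^2 limits of the same family, so their distance is below a quantity
  tending to 0.\<close>

lemma has_fourier_L2_unique:
  assumes [measurable]: "f \<in> borel_measurable lebesgue"
    and g: "has_fourier_L2 s f g" and h: "has_fourier_L2 s f h"
  shows "AE x in lebesgue. g x = h x"
proof -
  have [measurable]: "g \<in> borel_measurable lebesgue" "h \<in> borel_measurable lebesgue"
    using g h by (auto simp: has_fourier_L2_def square_integrable_def)
  let ?A = "\<lambda>R. fourier_int s (trunc R f)"
  have "((\<lambda>R. 2 * L2sq (\<lambda>x. ?A R x - g x) + 2 * L2sq (\<lambda>x. ?A R x - h x)) \<longlongrightarrow> 2 * 0 + 2 * 0) at_top"
    using g h unfolding has_fourier_L2_def by (intro tendsto_intros ennreal_tendsto_cmult) auto
  moreover have "L2sq (\<lambda>x. g x - h x) \<le> 2 * L2sq (\<lambda>x. ?A R x - g x) + 2 * L2sq (\<lambda>x. ?A R x - h x)" for R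
    using L2sq_triangle[of g "?A R" h] by (simp add: L2sq_def norm_minus_commute)
  ultimately have "L2sq (\<lambda>x. g x - h x) \<le> 2 * 0 + 2 * 0"
    by (intro tendsto_lowerbound[of _ _ at_top]) auto
  then have "AE x in lebesgue. g x - h x = 0"
    by (intro L2sq_eq_0_imp_AE) auto
  then show ?thesis by simp
qed

text \<open>By linearity the error is the transform of the tail of \<open>f\<close>, and the
  Plancherel bound makes it as small as the tail.\<close>

lemma has_fourier_L2_fourier_int:
  assumes f: "integrable lebesgue f" "square_integrable f" and s: "\<bar>s\<bar> = 1"
  shows "has_fourier_L2 s f (fourier_int s f)"
proof -
  have [measurable]: "f \<in> borel_measurable lebesgue" using f by (simp add: square_integrable_def)
  have le: "L2sq (\<lambda>\<xi>. fourier_int s (trunc R f) \<xi> - fourier_int s f \<xi>) \<le> L2sq (\<lambda>x. f x - trunc R f x)" for R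
    using L2sq_fourier_int_le[OF Bochner_Integration.integrable_diff[OF integrable_trunc[OF f(2), of R] f(1)] s]
    by (simp add: fourier_int_diff integrable_trunc f) (simp add: L2sq_def norm_minus_commute)
  have "((\<lambda>R. L2sq (\<lambda>\<xi>. fourier_int s (trunc R f) \<xi> - fourier_int s f \<xi>)) \<longlongrightarrow> 0) at_top"
    by (rule tendsto_sandwich[OF _ _ tendsto_const L2sq_tail_tendsto_0[OF f(2)]])
       (auto intro!: always_eventually le)
  moreover have "square_integrable (fourier_int s f)"
    using L2sq_fourier_int_le[OF f(1) s] f(2) by (auto simp: square_integrable_iff_L2sq)
  ultimately show ?thesis unfolding has_fourier_L2_def by simp
qed

lemma ex_has_fourier_L2:
  assumes f: "square_integrable f" and s: "\<bar>s\<bar> = 1"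
  shows "\<exists>g. has_fourier_L2 s f g"
proof -
  have [measurable]: "f \<in> borel_measurable lebesgue" using f by (simp add: square_integrable_def)
  let ?A = "\<lambda>R. fourier_int s (trunc R f)"
  have "\<exists>r. \<forall>R\<ge>r. L2sq (\<lambda>x. f x - trunc R f x) \<le> ennreal ((1 / 8) ^ m)" for m :: nat
  proof -
    have "\<forall>\<^sub>F R in at_top. L2sq (\<lambda>x. f x - trunc R f x) < ennreal ((1 / 8) ^ m)"
      by (rule order_tendstoD(2)[OF L2sq_tail_tendsto_0[OF f]]) simp
    then show ?thesis by (auto simp: eventually_at_top_linorder intro: less_imp_le)
  qed
  then obtain r where r: "\<And>m. L2sq (\<lambda>x. f x - trunc (r m) f x) \<le> ennreal ((1 / 8) ^ m)"
    by (meson order_refl)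
  have A_diff: "L2sq (\<lambda>\<xi>. ?A R \<xi> - ?A R' \<xi>) \<le> ennreal ((1 / 8) ^ m)" if "R \<ge> r m" "R' \<ge> r m" for R R' m
  proof -
    have "L2sq (\<lambda>\<xi>. ?A R \<xi> - ?A R' \<xi>) \<le> L2sq (\<lambda>x. trunc R f x - trunc R' f x)"
      using L2sq_fourier_int_le[OF Bochner_Integration.integrable_diff[OF integrable_trunc[OF f, of R] integrable_trunc[OF f, of R']] s]
      by (simp add: fourier_int_diff integrable_trunc f)
    also have "\<dots> \<le> L2sq (\<lambda>x. f x - trunc (r m) f x)"
      \<comment> \<open>Two truncations of radius at least \<open>r m\<close> agree inside that
        ball; outside, their difference is 0 or has modulus |f|, as does \<open>f\<close> minus
        \<open>trunc (r m) f\<close>.\<close>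
      by (rule L2sq_mono) (use that in \<open>auto simp: trunc_def indicator_def\<close>)
    finally show ?thesis using r order_trans by blast
  qed
  \<comment> \<open>The radii \<open>r m\<close> are chosen independently; the running maximum makes
    all later radii admissible for the m-th estimate.\<close>
  define q where "q m = Max (r ` {..m})" for m
  have q: "q n \<ge> r m" if "m \<le> n" for m n
    unfolding q_def using that by (intro Max_ge) auto
  obtain g where [measurable]: "g \<in> borel_measurable lebesgue"
    and g: "\<And>m. L2sq (\<lambda>x. ?A (q m) x - g x) \<le> ennreal ((1 / 8) ^ m)"
    using L2_complete_geometric[of "\<lambda>m. ?A (q m)"] A_diff q by (auto simp: Bex_def)
  \<comment> \<open>The constant 4 is 2 + 2 from \<open>L2sq_triangle\<close>. It carries
    convergence from the sequence of radii \<open>q m\<close> to all large real radii.\<close>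
  have bound: "L2sq (\<lambda>x. ?A R x - g x) \<le> ennreal (4 * (1 / 8) ^ m)" if "R \<ge> q m" for R m
  proof -
    have "L2sq (\<lambda>x. ?A R x - g x) \<le> 2 * L2sq (\<lambda>x. ?A R x - ?A (q m) x) + 2 * L2sq (\<lambda>x. ?A (q m) x - g x)"
      by (rule L2sq_triangle) measurable
    also have "\<dots> \<le> 2 * ennreal ((1 / 8) ^ m) + 2 * ennreal ((1 / 8) ^ m)"
      by (intro add_mono mult_left_mono g A_diff) (use that q[of m m] in auto)
    also have "\<dots> = ennreal (4 * (1 / 8) ^ m)"
      by (simp add: ennreal_mult mult.assoc flip: distrib_right)
    finally show ?thesis .
  qed
  have "((\<lambda>R. L2sq (\<lambda>x. ?A R x - g x)) \<longlongrightarrow> 0) at_top"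
  proof (rule order_tendstoI)
    fix e :: ennreal assume e: "e > 0"
    have "(\<lambda>m. ennreal (4 * (1 / 8) ^ m)) \<longlonglongrightarrow> ennreal (4 * 0)"
      by (intro tendsto_ennrealI tendsto_intros LIMSEQ_power_zero) simp
    then have "\<forall>\<^sub>F m in sequentially. ennreal (4 * (1 / 8) ^ m) < e"
      by (rule order_tendstoD) (use e in simp)
    then obtain m where m: "ennreal (4 * (1 / 8) ^ m) < e"
      by (auto simp: eventually_sequentially)
    show "\<forall>\<^sub>F R in at_top. L2sq (\<lambda>x. ?A R x - g x) < e"
      using eventually_ge_at_top[of "q m"] by eventually_elim (rule le_less_trans[OF bound m])
  qed simp
  moreover have "square_integrable g"
  proof -
    have i: "integrable lebesgue (trunc (q 0) f)" by (rule integrable_trunc[OF f])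
    have "L2sq (\<lambda>x. g x - 0) \<le> 2 * L2sq (\<lambda>x. g x - ?A (q 0) x) + 2 * L2sq (\<lambda>x. ?A (q 0) x - 0)"
      by (rule L2sq_triangle) measurable
    also have "\<dots> \<le> 2 * ennreal ((1 / 8) ^ 0) + 2 * L2sq f"
    proof (intro add_mono mult_left_mono)
      show "L2sq (\<lambda>x. g x - ?A (q 0) x) \<le> ennreal ((1 / 8) ^ 0)"
        using g[of 0] by (simp add: L2sq_def norm_minus_commute)
      have "L2sq (?A (q 0)) \<le> L2sq (trunc (q 0) f)" by (rule L2sq_fourier_int_le[OF i s])
      also have "\<dots> \<le> L2sq f" by (rule L2sq_mono) (auto simp: trunc_def indicator_def)
      finally show "L2sq (\<lambda>x. ?A (q 0) x - 0) \<le> L2sq f" by simp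
    qed auto
    also have "\<dots> < \<infinity>"
      using f by (simp add: square_integrable_iff_L2sq ennreal_mult_less_top)
    finally show ?thesis by (simp add: square_integrable_iff_L2sq)
  qed
  ultimately show ?thesis unfolding has_fourier_L2_def by blast
qed

lemma has_fourier_L2_fourier_L2:
  "square_integrable f \<Longrightarrow> \<bar>s\<bar> = 1 \<Longrightarrow> has_fourier_L2 s f (fourier_L2 s f)"
  unfolding fourier_L2_eq_SOME by (rule someI_ex[OF ex_has_fourier_L2])

lemma square_integrable_fourier_L2:
  "square_integrable f \<Longrightarrow> \<bar>s\<bar> = 1 \<Longrightarrow> square_integrable (fourier_L2 s f)"
  using has_fourier_L2_fourier_L2 unfolding has_fourier_L2_def by blast

text \<open>The means of computing \<open>fourier_L2\<close>: it suffices to exhibit any L^2 limit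
  of the truncated transforms.\<close>

lemma fourier_L2_AE_eqI:
  assumes "has_fourier_L2 s f g" "square_integrable f" "\<bar>s\<bar> = 1"
  shows "AE x in lebesgue. fourier_L2 s f x = g x"
  using assms has_fourier_L2_fourier_L2[OF assms(2,3)]
  by (intro has_fourier_L2_unique[of f s]) (auto simp: square_integrable_def)

lemma fourier_L2_AE_eq_fourier_int:
  assumes "integrable lebesgue f" "square_integrable f" "\<bar>s\<bar> = 1"
  shows "AE x in lebesgue. fourier_L2 s f x = fourier_int s f x"
  using assms by (intro fourier_L2_AE_eqI has_fourier_L2_fourier_int)

subsection \<open>Convolution and approximate identities\<close>

definition convol :: "('a::euclidean_space \<Rightarrow> complex) \<Rightarrow> ('a \<Rightarrow> complex) \<Rightarrow> 'a \<Rightarrow> complex" where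
  "convol h F \<xi> = (\<integral>\<eta>. h \<eta> * F (\<xi> - \<eta>) \<partial>lborel)"

lemma measurable_convol [measurable]:
  assumes [measurable]: "h \<in> borel_measurable borel" "F \<in> borel_measurable borel"
  shows "convol h F \<in> borel_measurable borel"
  unfolding convol_def[abs_def] by measurable

lemma ennreal_norm_convol_le:
  "ennreal (cmod (convol h F \<xi>)) \<le> (\<integral>\<^sup>+\<eta>. ennreal (cmod (h \<eta>)) * ennreal (cmod (F (\<xi> - \<eta>))) \<partial>lborel)"
  unfolding convol_def by (rule order_trans[OF ennreal_norm_integral_le]) (simp add: norm_mult ennreal_mult)

text \<open>The inner integral does not feel the shift by \<open>c *\<^sub>R \<eta>\<close>. The
  value \<open>c = 1\<close> serves convolution estimates, a general \<open>c\<close> the averages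
  over rescaled shifts.\<close>

lemma nn_integral_translates:
  fixes g G :: "'a::euclidean_space \<Rightarrow> ennreal"
  assumes [measurable]: "g \<in> borel_measurable borel" "G \<in> borel_measurable borel"
  shows "(\<integral>\<^sup>+\<xi>. (\<integral>\<^sup>+\<eta>. g \<eta> * G (\<xi> - c *\<^sub>R \<eta>) \<partial>lborel) \<partial>lborel) = (\<integral>\<^sup>+\<eta>. g \<eta> \<partial>lborel) * (\<integral>\<^sup>+\<xi>. G \<xi> \<partial>lborel)"
proof -
  have "(\<integral>\<^sup>+\<xi>. (\<integral>\<^sup>+\<eta>. g \<eta> * G (\<xi> - c *\<^sub>R \<eta>) \<partial>lborel) \<partial>lborel) = (\<integral>\<^sup>+\<eta>. (\<integral>\<^sup>+\<xi>. g \<eta> * G (\<xi> - c *\<^sub>R \<eta>) \<partial>lborel) \<partial>lborel)"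
    by (rule lborel_pair.Fubini') measurable
  also have "\<dots> = (\<integral>\<^sup>+\<eta>. g \<eta> * (\<integral>\<^sup>+\<xi>. G \<xi> \<partial>lborel) \<partial>lborel)"
    by (simp add: nn_integral_cmult nn_integral_lborel_translate)
  also have "\<dots> = (\<integral>\<^sup>+\<eta>. g \<eta> \<partial>lborel) * (\<integral>\<^sup>+\<xi>. G \<xi> \<partial>lborel)"
    by (simp add: nn_integral_multc)
  finally show ?thesis .
qed

lemma nn_integral_convol_le:
  fixes h F :: "'a::euclidean_space \<Rightarrow> complex"
  assumes [measurable]: "h \<in> borel_measurable borel" "F \<in> borel_measurable borel"
  shows "(\<integral>\<^sup>+\<xi>. ennreal (cmod (convol h F \<xi>)) \<partial>lborel) \<le>
    (\<integral>\<^sup>+\<eta>. ennreal (cmod (h \<eta>)) \<partial>lborel) * (\<integral>\<^sup>+\<xi>. ennreal (cmod (F \<xi>)) \<partial>lborel)"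
proof -
  have "(\<integral>\<^sup>+\<xi>. ennreal (cmod (convol h F \<xi>)) \<partial>lborel) \<le>
     (\<integral>\<^sup>+\<xi>. (\<integral>\<^sup>+\<eta>. ennreal (cmod (h \<eta>)) * ennreal (cmod (F (\<xi> - 1 *\<^sub>R \<eta>))) \<partial>lborel) \<partial>lborel)"
    by (rule nn_integral_mono) (simp add: ennreal_norm_convol_le)
  also have "\<dots> = (\<integral>\<^sup>+\<eta>. ennreal (cmod (h \<eta>)) \<partial>lborel) * (\<integral>\<^sup>+\<xi>. ennreal (cmod (F \<xi>)) \<partial>lborel)"
    by (rule nn_integral_translates) measurable
  finally show ?thesis .
qed

text \<open>Young's inequality for L^1 against L^2, obtained from Cauchy-Schwarz with |h| as
  weight.\<close>

lemma L2sq_convol_le: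
  fixes h F :: "'a::euclidean_space \<Rightarrow> complex"
  assumes [measurable]: "h \<in> borel_measurable borel" "F \<in> borel_measurable borel"
  shows "L2sq (convol h F) \<le> (\<integral>\<^sup>+\<eta>. ennreal (cmod (h \<eta>)) \<partial>lborel)\<^sup>2 * L2sq F"
proof -
  let ?a = "\<integral>\<^sup>+\<eta>. ennreal (cmod (h \<eta>)) \<partial>lborel"
  have "ennreal ((cmod (convol h F \<xi>))\<^sup>2) \<le> ?a * (\<integral>\<^sup>+\<eta>. ennreal (cmod (h \<eta>)) * ennreal ((cmod (F (\<xi> - 1 *\<^sub>R \<eta>)))\<^sup>2) \<partial>lborel)" for \<xi>
  proof -
    \<comment> \<open>Splitting |h| into two square roots gives one factor whose square integrates
      to the L^1 norm of \<open>h\<close> and one whose square carries |F|^2.\<close>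
    define p q where "p \<eta> = ennreal (sqrt (cmod (h \<eta>)))" and "q \<eta> = ennreal (sqrt (cmod (h \<eta>)) * cmod (F (\<xi> - \<eta>)))" for \<eta>
    have [measurable]: "p \<in> borel_measurable borel" "q \<in> borel_measurable borel"
      unfolding p_def[abs_def] q_def[abs_def] by measurable
    have pq: "p \<eta> * q \<eta> = ennreal (cmod (h \<eta>)) * ennreal (cmod (F (\<xi> - \<eta>)))"
      and p2: "(p \<eta>)\<^sup>2 = ennreal (cmod (h \<eta>))"
      and q2: "(q \<eta>)\<^sup>2 = ennreal (cmod (h \<eta>)) * ennreal ((cmod (F (\<xi> - 1 *\<^sub>R \<eta>)))\<^sup>2)" for \<eta>
      by (simp_all add: p_def q_def ennreal_power power_mult_distrib flip: ennreal_mult mult.assoc)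
    have "ennreal ((cmod (convol h F \<xi>))\<^sup>2) = (ennreal (cmod (convol h F \<xi>)))\<^sup>2"
      by (simp add: ennreal_power)
    also have "\<dots> \<le> (\<integral>\<^sup>+\<eta>. p \<eta> * q \<eta> \<partial>lborel)\<^sup>2"
      unfolding pq by (intro power_mono ennreal_norm_convol_le) simp
    also have "\<dots> \<le> (\<integral>\<^sup>+\<eta>. (p \<eta>)\<^sup>2 \<partial>lborel) * (\<integral>\<^sup>+\<eta>. (q \<eta>)\<^sup>2 \<partial>lborel)"
      by (rule Cauchy_Schwarz_nn_integral) measurable
    finally show ?thesis unfolding p2 q2 .
  qed
  then have "L2sq (convol h F) \<le> (\<integral>\<^sup>+\<xi>. ?a * (\<integral>\<^sup>+\<eta>. ennreal (cmod (h \<eta>)) * ennreal ((cmod (F (\<xi> - 1 *\<^sub>R \<eta>)))\<^sup>2) \<partial>lborel) \<partial>lborel)"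
    unfolding L2sq_lborel by (rule nn_integral_mono)
  also have "\<dots> = ?a * (\<integral>\<^sup>+\<xi>. (\<integral>\<^sup>+\<eta>. ennreal (cmod (h \<eta>)) * ennreal ((cmod (F (\<xi> - 1 *\<^sub>R \<eta>)))\<^sup>2) \<partial>lborel) \<partial>lborel)"
    by (rule nn_integral_cmult) measurable
  also have "\<dots> = ?a * (?a * L2sq F)"
    unfolding L2sq_lborel by (subst nn_integral_translates) measurable
  finally show ?thesis by (simp add: power2_eq_square mult.assoc)
qed

lemma AE_integrable_translates:
  fixes h F :: "'a::euclidean_space \<Rightarrow> complex"
  assumes h: "integrable lborel h" and F: "integrable lborel F"
  shows "AE \<xi> in lborel. integrable lborel (\<lambda>\<eta>. h \<eta> * F (\<xi> - c *\<^sub>R \<eta>))"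
proof -
  note [measurable] = borel_measurable_integrable[OF h, simplified] borel_measurable_integrable[OF F, simplified]
  have "(\<integral>\<^sup>+\<xi>. (\<integral>\<^sup>+\<eta>. ennreal (cmod (h \<eta>)) * ennreal (cmod (F (\<xi> - c *\<^sub>R \<eta>))) \<partial>lborel) \<partial>lborel) =
     (\<integral>\<^sup>+\<eta>. ennreal (cmod (h \<eta>)) \<partial>lborel) * (\<integral>\<^sup>+\<xi>. ennreal (cmod (F \<xi>)) \<partial>lborel)"
    by (rule nn_integral_translates) measurable
  also have "\<dots> < \<infinity>"
    using h F by (simp add: integrable_iff_bounded ennreal_mult_less_top)
  finally have "AE \<xi> in lborel. (\<integral>\<^sup>+\<eta>. ennreal (cmod (h \<eta>)) * ennreal (cmod (F (\<xi> - c *\<^sub>R \<eta>))) \<partial>lborel) \<noteq> \<infinity>"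
    by (intro nn_integral_PInf_AE) auto
  then show ?thesis
    by eventually_elim (simp add: integrable_iff_bounded norm_mult ennreal_mult less_top)
qed

lemma integral_lborel_affine:
  fixes f :: "'a::euclidean_space \<Rightarrow> 'b::{banach, second_countable_topology}"
  assumes [measurable]: "f \<in> borel_measurable borel" and c: "c \<noteq> 0"
  shows "(\<integral>x. f x \<partial>lborel) = (\<bar>c\<bar> ^ DIM('a)) *\<^sub>R (\<integral>x. f (t + c *\<^sub>R x) \<partial>lborel)"
proof -
  have "(\<integral>x. f x \<partial>lborel) = (\<integral>x. f x \<partial>density (distr lborel borel (\<lambda>x. t + c *\<^sub>R x)) (\<lambda>_. ennreal (\<bar>c\<bar> ^ DIM('a))))"
    using lborel_affine[OF c, of t] by simp
  also have "\<dots> = (\<integral>x. (\<bar>c\<bar> ^ DIM('a)) *\<^sub>R f (t + c *\<^sub>R x) \<partial>lborel)"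
    by (subst integral_density) (auto simp: integral_distr)
  finally show ?thesis by simp
qed

section \<open>Dilations\<close>

lemma measurable_dilate [measurable]:
  assumes [measurable]: "g \<in> borel_measurable borel"
  shows "dilate t g \<in> borel_measurable borel"
  unfolding dilate_def[abs_def] by measurable

lemma integral_dilate_mult:
  fixes g \<phi> :: "'a::euclidean_space \<Rightarrow> complex"
  assumes [measurable]: "g \<in> borel_measurable borel" "\<phi> \<in> borel_measurable borel" and t: "t > 0"
  shows "(\<integral>x. dilate t g x * \<phi> x \<partial>lborel) = (\<integral>x. g x * \<phi> (t *\<^sub>R x) \<partial>lborel)"
  using t by (subst integral_lborel_affine[of _ t 0])
    (simp_all add: dilate_def scaleR_conv_of_real field_simps flip: integral_mult_right_zero)

text \<open>The Jacobian t^d cancels one of the \<open>Suc n\<close> factors t^(-d). The case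
  \<open>n = 0\<close> is invariance of the L^1 norm; \<open>n = 1\<close> shows that L^2 is
  preserved, though not its norm.\<close>

lemma nn_integral_dilate_power:
  fixes g :: "'a::euclidean_space \<Rightarrow> complex"
  assumes [measurable]: "g \<in> borel_measurable borel" and t: "t > 0"
  shows "(\<integral>\<^sup>+x. ennreal (cmod (dilate t g x) ^ Suc n) \<partial>lborel) =
     ennreal (inverse (t ^ DIM('a)) ^ n) * (\<integral>\<^sup>+x. ennreal (cmod (g x) ^ Suc n) \<partial>lborel)"
proof -
  have "(\<integral>\<^sup>+x. ennreal (cmod (dilate t g x) ^ Suc n) \<partial>lborel) =
     ennreal (t ^ DIM('a)) * (\<integral>\<^sup>+x. ennreal (inverse (t ^ DIM('a)) ^ Suc n) * ennreal (cmod (g x) ^ Suc n) \<partial>lborel)"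
    using t by (subst nn_integral_lborel_affine[of _ t 0])
      (simp_all add: dilate_def norm_mult norm_inverse norm_power power_mult_distrib ennreal_mult mult_ac)
  also have "\<dots> = ennreal (t ^ DIM('a) * inverse (t ^ DIM('a)) ^ Suc n) * (\<integral>\<^sup>+x. ennreal (cmod (g x) ^ Suc n) \<partial>lborel)"
    using t by (subst nn_integral_cmult) (simp_all add: ennreal_mult mult.assoc)
  also have "t ^ DIM('a) * inverse (t ^ DIM('a)) ^ Suc n = inverse (t ^ DIM('a)) ^ n"
    using t by simp
  finally show ?thesis .
qed

lemma nn_integral_norm_dilate:
  fixes g :: "'a::euclidean_space \<Rightarrow> complex"
  assumes "g \<in> borel_measurable borel" "t > 0"
  shows "(\<integral>\<^sup>+x. ennreal (cmod (dilate t g x)) \<partial>lborel) = (\<integral>\<^sup>+x. ennreal (cmod (g x)) \<partial>lborel)"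
  using nn_integral_dilate_power[OF assms, of 0] by simp

lemma integrable_dilate:
  fixes g :: "'a::euclidean_space \<Rightarrow> complex"
  assumes g: "integrable lborel g" and t: "t > 0"
  shows "integrable lborel (dilate t g)"
  using g borel_measurable_integrable[OF g] nn_integral_norm_dilate[of g t] t
  by (simp add: integrable_iff_bounded)

lemma square_integrable_dilate:
  fixes g :: "'a::euclidean_space \<Rightarrow> complex"
  assumes [measurable]: "g \<in> borel_measurable borel" and g: "square_integrable g" and t: "t > 0"
  shows "square_integrable (dilate t g)"
  using g nn_integral_dilate_power[of g t 1] t
  by (simp add: square_integrable_iff_L2sq L2sq_lborel borel_imp_lebesgue_measurable ennreal_mult_less_top flip: power2_eq_square)

lemma fourier_int_dilate:
  fixes g :: "'a::euclidean_space \<Rightarrow> complex"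
  assumes [measurable]: "g \<in> borel_measurable borel" and t: "t > 0"
  shows "fourier_int s (dilate t g) \<xi> = fourier_int s g (t *\<^sub>R \<xi>)"
proof -
  have "(\<lambda>x. 1 * cis (s * 2 * pi * (x \<bullet> \<xi>))) \<in> borel_measurable borel"
    by (rule measurable_mult_cis) measurable
  then show ?thesis
    using t by (simp add: fourier_int_lborel integral_dilate_mult)
qed

lemma convol_dilate:
  fixes h F :: "'a::euclidean_space \<Rightarrow> complex"
  assumes [measurable]: "h \<in> borel_measurable borel" "F \<in> borel_measurable borel" and t: "t > 0"
  shows "convol (dilate t h) F \<xi> = (\<integral>u. h u * F (\<xi> - t *\<^sub>R u) \<partial>lborel)"
  unfolding convol_def using t by (subst integral_dilate_mult) auto

section \<open>Continuity of translation in L^1\<close>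

definition L1_shift :: "('a::euclidean_space \<Rightarrow> complex) \<Rightarrow> 'a \<Rightarrow> ennreal" where
  "L1_shift F v = (\<integral>\<^sup>+x. ennreal (cmod (F (x - v) - F x)) \<partial>lborel)"

text \<open>The approximation error is paid twice, once at \<open>x - v\<close> and once at
  \<open>x\<close>; both integrals agree by translation invariance.\<close>

lemma L1_shift_approx_le:
  fixes F G :: "'a::euclidean_space \<Rightarrow> complex"
  assumes [measurable]: "F \<in> borel_measurable borel" "G \<in> borel_measurable borel"
  shows "L1_shift F v \<le> 2 * (\<integral>\<^sup>+x. ennreal (cmod (F x - G x)) \<partial>lborel) + L1_shift G v"
proof -
  let ?d = "\<lambda>x. ennreal (cmod (F x - G x))"
  have "L1_shift F v \<le> (\<integral>\<^sup>+x. ?d (x - v) + (?d x + ennreal (cmod (G (x - v) - G x))) \<partial>lborel)"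
    unfolding L1_shift_def
  proof (rule nn_integral_mono)
    fix x
    have "cmod (F (x - v) - F x) \<le> cmod (F (x - v) - G (x - v)) + (cmod (F x - G x) + cmod (G (x - v) - G x))"
      using norm_triangle_ineq[of "F (x - v) - G (x - v)" "(G (x - v) - G x) + (G x - F x)"]
        norm_triangle_ineq[of "G (x - v) - G x" "G x - F x"] norm_minus_commute[of "F x" "G x"]
      by simp
    then show "ennreal (cmod (F (x - v) - F x)) \<le> ?d (x - v) + (?d x + ennreal (cmod (G (x - v) - G x)))"
      by (simp flip: ennreal_plus)
  qed
  also have "\<dots> = (\<integral>\<^sup>+x. ?d (x - v) \<partial>lborel) + ((\<integral>\<^sup>+x. ?d x \<partial>lborel) + L1_shift G v)"
    unfolding L1_shift_def by (simp add: nn_integral_add)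
  also have "(\<integral>\<^sup>+x. ?d (x - v) \<partial>lborel) = (\<integral>\<^sup>+x. ?d x \<partial>lborel)"
    by (rule nn_integral_lborel_translate[of ?d]) measurable
  finally show ?thesis by (simp add: mult_2 add.assoc)
qed

lemma L1_shift_le:
  assumes [measurable]: "F \<in> borel_measurable borel"
  shows "L1_shift F v \<le> 2 * (\<integral>\<^sup>+x. ennreal (cmod (F x)) \<partial>lborel)"
  using L1_shift_approx_le[of F "\<lambda>_. 0" v] by (simp add: L1_shift_def)

text \<open>Functions whose translates converge in L^1 form a closed set, since the error of
  approximation is uniform in the shift.\<close>

lemma L1_shift_tendsto_0_closure:
  fixes F :: "'a::euclidean_space \<Rightarrow> complex"
  assumes [measurable]: "F \<in> borel_measurable borel"
    and approx: "\<And>e::real. e > 0 \<Longrightarrow> \<exists>G\<in>borel_measurable borel.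
       (\<integral>\<^sup>+x. ennreal (cmod (F x - G x)) \<partial>lborel) \<le> ennreal e \<and> (\<lambda>n. L1_shift G (v n)) \<longlonglongrightarrow> 0"
  shows "(\<lambda>n. L1_shift F (v n)) \<longlonglongrightarrow> 0"
proof (rule order_tendstoI)
  fix e :: ennreal assume "0 < e"
  then obtain y where y: "0 < y" "y < e" using dense by blast
  then obtain r where r: "y = ennreal r" "r > 0"
    by (cases y) (auto simp: ennreal_less_zero_iff)
  \<comment> \<open>With tolerance \<open>r / 4\<close> the total is
    \<open>2 * (r / 4) + r / 4\<close>, which is below \<open>r\<close>.\<close>
  obtain G where G: "G \<in> borel_measurable borel" "(\<integral>\<^sup>+x. ennreal (cmod (F x - G x)) \<partial>lborel) \<le> ennreal (r / 4)"
    "(\<lambda>n. L1_shift G (v n)) \<longlonglongrightarrow> 0"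
    using approx[of "r / 4"] r(2) by auto
  have "\<forall>\<^sub>F n in sequentially. L1_shift G (v n) < ennreal (r / 4)"
    by (rule order_tendstoD(2)[OF G(3)]) (use r in simp)
  then show "\<forall>\<^sub>F n in sequentially. L1_shift F (v n) < e"
  proof eventually_elim
    case (elim n)
    have two: "ennreal 2 * ennreal (r / 4) = ennreal (2 * (r / 4))"
      using r(2) by (intro ennreal_mult[symmetric]) auto
    have "L1_shift F (v n) \<le> ennreal 2 * ennreal (r / 4) + ennreal (r / 4)"
      by (rule order_trans[OF L1_shift_approx_le[OF assms(1) G(1)]])
         (simp only: ennreal_numeral, intro add_mono mult_left_mono G(2) less_imp_le[OF elim], simp)
    also have "\<dots> = ennreal (2 * (r / 4) + r / 4)"
      unfolding two using r(2) by (intro ennreal_plus[symmetric]) auto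
    also have "\<dots> \<le> y" unfolding r(1) using r(2) by (intro ennreal_leI) simp
    finally show ?case using y(2) by simp
  qed
qed simp

text \<open>Openness makes \<open>(1\<^sub>U(x) - 1\<^sub>U(x - v))\<^sup>+\<close> vanish as \<open>v \<rightarrow> 0\<close>; the negative part has the same
  integral because translation preserves the measure of \<open>U\<close>.\<close>

lemma L1_shift_indicator_open:
  fixes U :: "'a::euclidean_space set" and c :: complex
  assumes U: "open U" and fin: "emeasure lborel U < \<infinity>" and v: "v \<longlonglongrightarrow> 0"
  shows "(\<lambda>n. L1_shift (\<lambda>x. indicator U x *\<^sub>R c) (v n)) \<longlonglongrightarrow> 0"
proof -
  have [measurable]: "U \<in> sets borel" using U by simp
  define p where "p n x = ennreal (if x \<in> U \<and> x - v n \<notin> U then 1 else 0)" for n x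
  define m where "m n x = ennreal (if x \<notin> U \<and> x - v n \<in> U then 1 else 0)" for n x
  have [measurable]: "p n \<in> borel_measurable borel" "m n \<in> borel_measurable borel" for n
    unfolding p_def[abs_def] m_def[abs_def] by measurable
  have pm: "(\<integral>\<^sup>+x. m n x \<partial>lborel) = (\<integral>\<^sup>+x. p n x \<partial>lborel)" for n
  proof -
    have "(\<integral>\<^sup>+x. m n x \<partial>lborel) + emeasure lborel U = (\<integral>\<^sup>+x. m n x + indicator U x \<partial>lborel)"
      by (simp add: nn_integral_add)
    also have "\<dots> = (\<integral>\<^sup>+x. p n x + indicator U (x - v n) \<partial>lborel)"
      by (intro nn_integral_cong) (auto simp: m_def p_def)
    also have "\<dots> = (\<integral>\<^sup>+x. p n x \<partial>lborel) + (\<integral>\<^sup>+x. indicator U (x - v n) \<partial>lborel)"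
      by (rule nn_integral_add) measurable
    also have "(\<integral>\<^sup>+x. indicator U (x - v n) \<partial>lborel) = emeasure lborel U"
      by (subst nn_integral_lborel_translate) auto
    finally show ?thesis using fin
      by (metis add.commute ennreal_add_left_cancel infinity_ennreal_def less_irrefl)
  qed
  have "(\<lambda>n. \<integral>\<^sup>+x. p n x \<partial>lborel) \<longlonglongrightarrow> integral\<^sup>N lborel (\<lambda>x::'a. 0)"
  proof (rule nn_integral_dominated_convergence[where w = "indicator U"])
    show "AE x in lborel. (\<lambda>n. p n x) \<longlonglongrightarrow> 0"
    proof (rule AE_I2)
      fix x
      show "(\<lambda>n. p n x) \<longlonglongrightarrow> 0"
      proof (cases "x \<in> U")
        case True
        have "(\<lambda>n. x - v n) \<longlonglongrightarrow> x - 0" by (intro tendsto_intros v)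
        then have "\<forall>\<^sub>F n in sequentially. x - v n \<in> U"
          using U True by (intro topological_tendstoD) auto
        then have "\<forall>\<^sub>F n in sequentially. p n x = 0"
          by eventually_elim (simp add: p_def)
        then show ?thesis by (rule tendsto_eventually)
      qed (simp add: p_def)
    qed
  qed (use fin in \<open>auto simp: p_def\<close>)
  then have "(\<lambda>n. ennreal (cmod c) * ((\<integral>\<^sup>+x. p n x \<partial>lborel) + (\<integral>\<^sup>+x. p n x \<partial>lborel))) \<longlonglongrightarrow> ennreal (cmod c) * (0 + 0)"
    by (intro ennreal_tendsto_cmult tendsto_add) auto
  moreover have "L1_shift (\<lambda>x. indicator U x *\<^sub>R c) (v n) = ennreal (cmod c) * ((\<integral>\<^sup>+x. p n x \<partial>lborel) + (\<integral>\<^sup>+x. p n x \<partial>lborel))" for n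
  proof -
    have "L1_shift (\<lambda>x. indicator U x *\<^sub>R c) (v n) = (\<integral>\<^sup>+x. ennreal (cmod c) * (m n x + p n x) \<partial>lborel)"
      unfolding L1_shift_def by (intro nn_integral_cong) (auto simp: m_def p_def indicator_def)
    also have "\<dots> = ennreal (cmod c) * ((\<integral>\<^sup>+x. m n x \<partial>lborel) + (\<integral>\<^sup>+x. p n x \<partial>lborel))"
      by (simp add: nn_integral_cmult nn_integral_add)
    finally show ?thesis unfolding pm .
  qed
  ultimately show ?thesis by simp
qed

lemma L1_shift_tendsto_0:
  fixes F :: "'a::euclidean_space \<Rightarrow> complex"
  assumes F: "integrable lborel F" and v: "v \<longlonglongrightarrow> 0"
  shows "(\<lambda>n. L1_shift F (v n)) \<longlonglongrightarrow> 0"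
  using F
proof (induction rule: integrable_induct)
  case (base A c)
  then have [measurable]: "A \<in> sets borel" by simp
  show ?case
  proof (rule L1_shift_tendsto_0_closure)
    fix e :: real assume e: "e > 0"
    \<comment> \<open>Outer regularity trades \<open>A\<close> for an open set, for which
      convergence is already known. Multiplied by \<open>cmod c\<close>, this tolerance stays below
      \<open>e\<close>, and the summand 1 covers \<open>c = 0\<close>.\<close>
    have "e / (1 + cmod c) > 0" using e by (simp add: add_pos_nonneg)
    then obtain U where U: "open U" "A \<subseteq> U" "emeasure lborel (U - A) \<le> ennreal (e / (1 + cmod c))"
      using outer_regular_lborel_le[OF \<open>A \<in> sets borel\<close>] by metis
    have [measurable]: "U \<in> sets borel" using U by simp
    have "A \<union> (U - A) = U" using U(2) by blast
    then have "emeasure lborel U \<le> emeasure lborel A + emeasure lborel (U - A)"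
      using emeasure_subadditive[of A lborel "U - A"] by simp
    also have "\<dots> < \<infinity>"
      using base(2) U(3) by (auto simp: less_top[symmetric] top_unique)
    finally have fin: "emeasure lborel U < \<infinity>" .
    have "(\<integral>\<^sup>+x. ennreal (cmod (indicator A x *\<^sub>R c - indicator U x *\<^sub>R c)) \<partial>lborel) =
        (\<integral>\<^sup>+x. ennreal (cmod c) * indicator (U - A) x \<partial>lborel)"
      using U(2) by (intro nn_integral_cong) (auto simp: indicator_def)
    also have "\<dots> = ennreal (cmod c) * emeasure lborel (U - A)"
      by (simp add: nn_integral_cmult)
    also have "\<dots> \<le> ennreal (cmod c) * ennreal (e / (1 + cmod c))"
      by (intro mult_left_mono U(3)) simp
    also have "\<dots> = ennreal (cmod c * (e / (1 + cmod c)))"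
      using e by (intro ennreal_mult[symmetric]) auto
    also have "\<dots> \<le> ennreal e"
      using e by (intro ennreal_leI) (simp add: field_simps add_pos_nonneg)
    finally show "\<exists>G\<in>borel_measurable borel.
       (\<integral>\<^sup>+x. ennreal (cmod (indicator A x *\<^sub>R c - G x)) \<partial>lborel) \<le> ennreal e \<and> (\<lambda>n. L1_shift G (v n)) \<longlonglongrightarrow> 0"
      using L1_shift_indicator_open[OF U(1) fin v, of c]
      by (intro bexI[of _ "\<lambda>x. indicator U x *\<^sub>R c"]) auto
  qed measurable
next
  case (add f g)
  note [measurable] = borel_measurable_integrable[OF add.hyps(1), simplified] borel_measurable_integrable[OF add.hyps(2), simplified]
  have "(\<lambda>n. L1_shift f (v n) + L1_shift g (v n)) \<longlonglongrightarrow> 0 + 0"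
    by (intro tendsto_add add.IH)
  then have lim: "(\<lambda>n. L1_shift f (v n) + L1_shift g (v n)) \<longlonglongrightarrow> 0" by simp
  have "L1_shift (\<lambda>x. f x + g x) w \<le> L1_shift f w + L1_shift g w" for w
  proof -
    have "L1_shift (\<lambda>x. f x + g x) w \<le> (\<integral>\<^sup>+x. ennreal (cmod (f (x - w) - f x)) + ennreal (cmod (g (x - w) - g x)) \<partial>lborel)"
      unfolding L1_shift_def
    proof (rule nn_integral_mono)
      fix x
      have "cmod (f (x - w) + g (x - w) - (f x + g x)) \<le> cmod (f (x - w) - f x) + cmod (g (x - w) - g x)"
        by (rule norm_diff_triangle_ineq)
      then show "ennreal (cmod (f (x - w) + g (x - w) - (f x + g x))) \<le> ennreal (cmod (f (x - w) - f x)) + ennreal (cmod (g (x - w) - g x))"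
        by (simp flip: ennreal_plus)
    qed
    also have "\<dots> = L1_shift f w + L1_shift g w"
      unfolding L1_shift_def by (rule nn_integral_add) measurable
    finally show ?thesis .
  qed
  then show ?case
    by (intro tendsto_sandwich[OF _ _ tendsto_const lim]) auto
next
  case (lim f s)
  note [measurable] = borel_measurable_integrable[OF lim.hyps(1), simplified] borel_measurable_integrable[OF lim.hyps(4), simplified]
  \<comment> \<open>The approximants supplied by the induction satisfy |s i| \<le> 2 |f|, so
    pointwise convergence improves to convergence in L^1.\<close>
  have conv: "(\<lambda>i. (\<integral>\<^sup>+x. ennreal (cmod (f x - s i x)) \<partial>lborel)) \<longlonglongrightarrow> 0"
  proof (rule nn_integral_dominated_convergence_norm[where w = "\<lambda>x. 2 * cmod (f x)"])
    show "(\<integral>\<^sup>+x. ennreal (2 * cmod (f x)) \<partial>lborel) < \<infinity>"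
      using lim.hyps(4) by (simp add: integrable_iff_bounded ennreal_mult nn_integral_cmult ennreal_mult_less_top)
  qed (use lim in auto)
  show ?case
  proof (rule L1_shift_tendsto_0_closure)
    fix e :: real assume "e > 0"
    then have "\<forall>\<^sub>F i in sequentially. (\<integral>\<^sup>+x. ennreal (cmod (f x - s i x)) \<partial>lborel) < ennreal e"
      by (intro order_tendstoD(2)[OF conv]) simp
    then obtain i where "(\<integral>\<^sup>+x. ennreal (cmod (f x - s i x)) \<partial>lborel) < ennreal e"
      by (auto simp: eventually_sequentially)
    then show "\<exists>G\<in>borel_measurable borel. (\<integral>\<^sup>+x. ennreal (cmod (f x - G x)) \<partial>lborel) \<le> ennreal e \<and> (\<lambda>n. L1_shift G (v n)) \<longlonglongrightarrow> 0"
      using lim.IH by (intro bexI[of _ "s i"]) auto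
  qed measurable
qed

lemma measurable_L1_shift [measurable]:
  assumes [measurable]: "F \<in> borel_measurable borel"
  shows "L1_shift F \<in> borel_measurable borel"
  unfolding L1_shift_def[abs_def] by measurable

text \<open>After rescaling, the convolution averages the translates of \<open>F\<close> by
  \<open>t *\<^sub>R u\<close> with weight \<open>h u\<close>. Its L^1 error is at most the weighted
  average of \<open>L1_shift F\<close>, which tends to 0 for each \<open>u\<close>.\<close>

lemma convol_dilate_L1_tendsto:
  fixes h F :: "'a::euclidean_space \<Rightarrow> complex"
  assumes h: "integrable lborel h" "(\<integral>x. h x \<partial>lborel) = 1" and F: "integrable lborel F"
  shows "((\<lambda>t. \<integral>\<^sup>+\<xi>. ennreal (cmod (convol (dilate t h) F \<xi> - F \<xi>)) \<partial>lborel) \<longlongrightarrow> 0) (at_right 0)"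
proof -
  note [measurable] = borel_measurable_integrable[OF h(1), simplified] borel_measurable_integrable[OF F, simplified]
  have bound: "(\<integral>\<^sup>+\<xi>. ennreal (cmod (convol (dilate t h) F \<xi> - F \<xi>)) \<partial>lborel)
      \<le> (\<integral>\<^sup>+u. ennreal (cmod (h u)) * L1_shift F (t *\<^sub>R u) \<partial>lborel)" if t: "t > 0" for t
  proof -
    have "(\<integral>\<^sup>+\<xi>. ennreal (cmod (convol (dilate t h) F \<xi> - F \<xi>)) \<partial>lborel)
      \<le> (\<integral>\<^sup>+\<xi>. (\<integral>\<^sup>+u. ennreal (cmod (h u)) * ennreal (cmod (F (\<xi> - t *\<^sub>R u) - F \<xi>)) \<partial>lborel) \<partial>lborel)"
    proof (rule nn_integral_mono_AE, use AE_integrable_translates[OF h(1) F, of t] in eventually_elim)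
      case (elim \<xi>)
      \<comment> \<open>As \<open>h\<close> has integral 1, the value \<open>F \<xi>\<close> is
        itself an average with weight \<open>h\<close>.\<close>
      have "convol (dilate t h) F \<xi> - F \<xi> = (\<integral>u. h u * F (\<xi> - t *\<^sub>R u) \<partial>lborel) - (\<integral>u. h u * F \<xi> \<partial>lborel)"
        using t h(2) by (simp add: convol_dilate)
      also have "\<dots> = (\<integral>u. h u * (F (\<xi> - t *\<^sub>R u) - F \<xi>) \<partial>lborel)"
        using elim h(1) by (subst Bochner_Integration.integral_diff[symmetric]) (auto simp: right_diff_distrib)
      finally have eq: "convol (dilate t h) F \<xi> - F \<xi> = \<dots>" .
      show ?case
        unfolding eq by (rule order_trans[OF ennreal_norm_integral_le]) (simp add: norm_mult ennreal_mult)
    qed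
    also have "\<dots> = (\<integral>\<^sup>+u. (\<integral>\<^sup>+\<xi>. ennreal (cmod (h u)) * ennreal (cmod (F (\<xi> - t *\<^sub>R u) - F \<xi>)) \<partial>lborel) \<partial>lborel)"
      by (rule lborel_pair.Fubini') measurable
    also have "\<dots> = (\<integral>\<^sup>+u. ennreal (cmod (h u)) * L1_shift F (t *\<^sub>R u) \<partial>lborel)"
      by (simp add: nn_integral_cmult L1_shift_def)
    finally show ?thesis .
  qed
  have lim: "((\<lambda>t. \<integral>\<^sup>+u. ennreal (cmod (h u)) * L1_shift F (t *\<^sub>R u) \<partial>lborel) \<longlongrightarrow> 0) (at_right 0)"
    \<comment> \<open>Dominated convergence is available for sequences; \<open>L1_shift_le\<close>
      supplies a dominating function independent of the scale.\<close>
    unfolding tendsto_at_iff_sequentially comp_def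
  proof (intro allI impI)
    fix X :: "nat \<Rightarrow> real" assume X: "X \<longlonglongrightarrow> 0"
    let ?K = "2 * (\<integral>\<^sup>+x. ennreal (cmod (F x)) \<partial>lborel)"
    have K: "?K < \<infinity>" using F by (simp add: integrable_iff_bounded ennreal_mult_less_top)
    have "(\<lambda>n. \<integral>\<^sup>+u. ennreal (cmod (h u)) * L1_shift F (X n *\<^sub>R u) \<partial>lborel) \<longlonglongrightarrow> integral\<^sup>N lborel (\<lambda>u::'a. 0)"
    proof (rule nn_integral_dominated_convergence[where w = "\<lambda>u. ennreal (cmod (h u)) * ?K"])
      show "AE u in lborel. (\<lambda>n. ennreal (cmod (h u)) * L1_shift F (X n *\<^sub>R u)) \<longlonglongrightarrow> 0"
      proof (rule AE_I2)
        fix u :: 'a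
        have "(\<lambda>n. X n *\<^sub>R u) \<longlonglongrightarrow> 0 *\<^sub>R u" by (intro tendsto_intros X)
        then have "(\<lambda>n. L1_shift F (X n *\<^sub>R u)) \<longlonglongrightarrow> 0"
          by (intro L1_shift_tendsto_0 F) simp
        then have "(\<lambda>n. ennreal (cmod (h u)) * L1_shift F (X n *\<^sub>R u)) \<longlonglongrightarrow> ennreal (cmod (h u)) * 0"
          by (intro ennreal_tendsto_cmult) auto
        then show "(\<lambda>n. ennreal (cmod (h u)) * L1_shift F (X n *\<^sub>R u)) \<longlonglongrightarrow> 0" by simp
      qed
      show "(\<integral>\<^sup>+u. ennreal (cmod (h u)) * ?K \<partial>lborel) < \<infinity>"
        using K h(1) by (subst nn_integral_multc) (auto simp: integrable_iff_bounded ennreal_mult_less_top)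
    qed (auto intro!: mult_left_mono L1_shift_le)
    then show "(\<lambda>n. \<integral>\<^sup>+u. ennreal (cmod (h u)) * L1_shift F (X n *\<^sub>R u) \<partial>lborel) \<longlonglongrightarrow> 0" by simp
  qed
  show ?thesis
    by (rule tendsto_sandwich[OF _ _ tendsto_const lim])
       (auto simp: eventually_at_right_less intro!: eventually_mono[OF eventually_at_right_less bound])
qed

subsection \<open>Multipliers\<close>

text \<open>Modulating \<phi> by the character at \<xi> shifts its transform to \<xi> - \<eta>; the
  multiplication formula then moves the transform off \<open>h\<close> and leaves a
  convolution.\<close>

lemma fourier_int_mult_fourier_int:
  fixes h \<phi> :: "'a::euclidean_space \<Rightarrow> complex"
  assumes h: "integrable lborel h" and \<phi>: "integrable lborel \<phi>"
  shows "fourier_int (- s) (\<lambda>y. fourier_int s h y * \<phi> y) \<xi> = convol h (fourier_int (- s) \<phi>) \<xi>"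
proof -
  note [measurable] = borel_measurable_integrable[OF h, simplified] borel_measurable_integrable[OF \<phi>, simplified]
  define g where "g y = \<phi> y * cis (- s * 2 * pi * (y \<bullet> \<xi>))" for y
  have ig: "integrable lborel g"
    unfolding g_def[abs_def] by (rule integrable_mult_cis[OF \<phi>]) measurable
  note [measurable] = borel_measurable_integrable[OF ig, simplified]
  have g: "fourier_int s g \<eta> = fourier_int (- s) \<phi> (\<xi> - \<eta>)" for \<eta>
  proof -
    have "cis (- s * 2 * pi * (y \<bullet> \<xi>)) * cis (s * 2 * pi * (y \<bullet> \<eta>)) = cis (- s * 2 * pi * (y \<bullet> (\<xi> - \<eta>)))" for y
      by (simp add: cis_mult inner_diff_right algebra_simps)
    then show ?thesis
      by (simp add: fourier_int_lborel g_def mult.assoc)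
  qed
  have "fourier_int (- s) (\<lambda>y. fourier_int s h y * \<phi> y) \<xi> = (\<integral>y. fourier_int s h y * g y \<partial>lborel)"
    by (subst fourier_int_lborel) (auto simp: g_def mult.assoc)
  also have "\<dots> = (\<integral>\<eta>. h \<eta> * fourier_int s g \<eta> \<partial>lborel)"
    by (rule integral_fourier_int_mult[OF h ig])
  finally show ?thesis unfolding g convol_def .
qed

lemma square_integrable_mult_bounded:
  assumes \<phi> [measurable]: "\<phi> \<in> borel_measurable lebesgue" and C: "\<And>x. cmod (\<phi> x) \<le> C"
    and f: "square_integrable f"
  shows "square_integrable (\<lambda>x. \<phi> x * f x)"
  unfolding square_integrable_def
proof
  have [measurable]: "f \<in> borel_measurable lebesgue" using f by (simp add: square_integrable_def)
  show "(\<lambda>x. \<phi> x * f x) \<in> borel_measurable lebesgue" by measurable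
  have "integrable lebesgue (\<lambda>x. C\<^sup>2 * (cmod (f x))\<^sup>2)"
    using f by (simp add: square_integrable_def)
  then show "integrable lebesgue (\<lambda>x. (cmod (\<phi> x * f x))\<^sup>2)"
    by (rule Bochner_Integration.integrable_bound)
       (measurable, auto simp: norm_mult power_mult_distrib intro!: mult_right_mono power_mono C)
qed

lemma integrable_mult_bounded:
  fixes f :: "'a \<Rightarrow> complex"
  assumes \<phi> [measurable]: "\<phi> \<in> borel_measurable M" and C: "\<And>x. cmod (\<phi> x) \<le> C"
    and f: "integrable M f"
  shows "integrable M (\<lambda>x. \<phi> x * f x)"
proof -
  note [measurable] = borel_measurable_integrable[OF f]
  have "cmod (\<phi> x) \<le> \<bar>C\<bar>" for x using C[of x] by linarith
  then have "AE x in M. norm (\<phi> x * f x) \<le> norm (C * cmod (f x))"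
    by (auto simp: norm_mult abs_mult intro!: mult_right_mono)
  then show ?thesis
    by (intro Bochner_Integration.integrable_bound[OF integrable_mult_right[OF integrable_norm[OF f], of C]]) auto
qed

text \<open>For each truncation, which lies in L^1, the convolution identity is exact. Young's bound
  makes convolution with \<open>h\<close> continuous on L^2, so the identity survives the limit in
  the radius.\<close>

lemma has_fourier_L2_mult_fourier_int:
  fixes h f F :: "'a::euclidean_space \<Rightarrow> complex"
  assumes h: "integrable lborel h"
    and f [measurable]: "f \<in> borel_measurable borel" and f2: "square_integrable f"
    and F: "integrable lborel F" and fF: "has_fourier_L2 (- s) f F"
  shows "has_fourier_L2 (- s) (\<lambda>y. fourier_int s h y * f y) (convol h F)"
proof -
  note [measurable] = borel_measurable_integrable[OF h, simplified] borel_measurable_integrable[OF F, simplified]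
  let ?a = "\<integral>\<^sup>+\<eta>. ennreal (cmod (h \<eta>)) \<partial>lborel"
  have a: "?a < \<infinity>" using h by (simp add: integrable_iff_bounded)
  then have a2: "?a\<^sup>2 < \<infinity>" by (simp add: power2_eq_square ennreal_mult_less_top)
  have trm [measurable]: "trunc R f \<in> borel_measurable borel" for R
  proof -
    have [measurable]: "(indicator (ball 0 R) :: 'a \<Rightarrow> complex) \<in> borel_measurable borel"
      by (intro borel_measurable_indicator) simp
    show ?thesis unfolding trunc_def[abs_def] by measurable
  qed
  have tri: "integrable lborel (trunc R f)" for R
    using integrable_trunc[OF f2, of R] by (subst (asm) integrable_completion) auto
  have eq: "fourier_int (- s) (trunc R (\<lambda>y. fourier_int s h y * f y)) = convol h (fourier_int (- s) (trunc R f))" for R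
  proof
    fix \<xi>
    have "trunc R (\<lambda>y. fourier_int s h y * f y) = (\<lambda>y. fourier_int s h y * trunc R f y)"
      by (auto simp: trunc_def)
    then show "fourier_int (- s) (trunc R (\<lambda>y. fourier_int s h y * f y)) \<xi> = convol h (fourier_int (- s) (trunc R f)) \<xi>"
      using fourier_int_mult_fourier_int[OF h tri] by simp
  qed
  have bound: "L2sq (\<lambda>\<xi>. convol h (fourier_int (- s) (trunc R f)) \<xi> - convol h F \<xi>) \<le>
     ?a\<^sup>2 * L2sq (\<lambda>\<xi>. fourier_int (- s) (trunc R f) \<xi> - F \<xi>)" for R
  proof -
    let ?D = "\<lambda>\<xi>. fourier_int (- s) (trunc R f) \<xi> - F \<xi>"
    \<comment> \<open>Linearity of the convolution needs both integrands integrable: for the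
      transform this holds at every point because it is bounded, for \<open>F\<close> at almost
      every point by Tonelli.\<close>
    have "AE \<xi> in lborel. convol h (fourier_int (- s) (trunc R f)) \<xi> - convol h F \<xi> = convol h ?D \<xi>"
      using AE_integrable_translates[OF h F, of 1]
    proof eventually_elim
      case (elim \<xi>)
      have "integrable lborel (\<lambda>\<eta>. fourier_int (- s) (trunc R f) (\<xi> - \<eta>) * h \<eta>)"
        by (rule integrable_mult_bounded[OF _ norm_fourier_int_le h]) measurable
      then have "integrable lborel (\<lambda>\<eta>. h \<eta> * fourier_int (- s) (trunc R f) (\<xi> - \<eta>))"
        by (simp add: mult.commute)
      then show ?case
        using elim unfolding convol_def
        by (subst Bochner_Integration.integral_diff[symmetric]) (auto simp: right_diff_distrib)
    qed
    then have "L2sq (\<lambda>\<xi>. convol h (fourier_int (- s) (trunc R f)) \<xi> - convol h F \<xi>) = L2sq (convol h ?D)"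
      by (intro L2sq_cong_AE AE_completion)
    also have "\<dots> \<le> ?a\<^sup>2 * L2sq ?D"
      by (rule L2sq_convol_le) measurable
    finally show ?thesis .
  qed
  have "((\<lambda>R. ?a\<^sup>2 * L2sq (\<lambda>\<xi>. fourier_int (- s) (trunc R f) \<xi> - F \<xi>)) \<longlongrightarrow> ?a\<^sup>2 * 0) at_top"
    using fF a2 unfolding has_fourier_L2_def by (intro ennreal_tendsto_cmult) auto
  then have lim0: "((\<lambda>R. ?a\<^sup>2 * L2sq (\<lambda>\<xi>. fourier_int (- s) (trunc R f) \<xi> - F \<xi>)) \<longlongrightarrow> 0) at_top"
    by simp
  have "((\<lambda>R. L2sq (\<lambda>\<xi>. convol h (fourier_int (- s) (trunc R f)) \<xi> - convol h F \<xi>)) \<longlongrightarrow> 0) at_top"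
    by (rule tendsto_sandwich[OF _ _ tendsto_const lim0]) (auto intro!: always_eventually bound)
  moreover have "square_integrable (convol h F)"
  proof -
    have "L2sq F < \<infinity>" using fF by (simp add: has_fourier_L2_def square_integrable_iff_L2sq)
    then have "?a\<^sup>2 * L2sq F < \<infinity>" using a2 by (simp add: ennreal_mult_less_top)
    then show ?thesis
      using L2sq_convol_le[of h F] by (auto simp: square_integrable_iff_L2sq borel_imp_lebesgue_measurable)
  qed
  ultimately show ?thesis unfolding has_fourier_L2_def eq by simp
qed

section \<open>Independence of representatives\<close>

lemma fourier_L2_cong_AE:
  assumes [measurable]: "f \<in> borel_measurable lebesgue" "g \<in> borel_measurable lebesgue"
    and ae: "AE x in lebesgue. f x = g x"
  shows "fourier_L2 s f = fourier_L2 s g"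
proof -
  have "fourier_int s (trunc R f) = fourier_int s (trunc R g)" for R
    by (rule fourier_int_cong_AE) (use ae in \<open>auto simp: trunc_def elim!: eventually_mono\<close>)
  \<comment> \<open>The two predicates under \<open>SOME\<close> coincide, so the same function is
    chosen; the transforms are equal everywhere, not only almost everywhere.\<close>
  then show ?thesis unfolding fourier_L2_eq_SOME has_fourier_L2_def by simp
qed

lemma AE_lborel_scaleR:
  fixes P :: "'a::euclidean_space \<Rightarrow> bool"
  assumes "AE x in lborel. P x" and c: "c \<noteq> 0"
  shows "AE x in lborel. P (c *\<^sub>R x)"
proof -
  obtain N where N: "{x. \<not> P x} \<subseteq> N" "N \<in> sets borel" "emeasure lborel N = 0"
    using assms(1) by (auto elim!: AE_E)
  note [measurable] = N(2)
  have "ennreal (\<bar>c\<bar> ^ DIM('a)) * (\<integral>\<^sup>+x. indicator N (c *\<^sub>R x) \<partial>lborel) = 0"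
    using nn_integral_lborel_affine[of "indicator N" c "0::'a"] c N by simp
  moreover have "\<bar>c\<bar> ^ DIM('a) > 0" using c by simp
  then have "ennreal (\<bar>c\<bar> ^ DIM('a)) \<noteq> 0" by (metis ennreal_eq_0_iff not_le)
  ultimately have "(\<integral>\<^sup>+x. indicator N (c *\<^sub>R x) \<partial>lborel) = (0::ennreal)"
    by (metis mult_eq_0_iff)
  then have "AE x in lborel. indicator N (c *\<^sub>R x) = (0::ennreal)"
    by (subst (asm) nn_integral_0_iff_AE) auto
  then show ?thesis
    by eventually_elim (use N(1) in \<open>auto split: split_indicator_asm\<close>)
qed

text \<open>Scaling preserves null sets, so dilation respects almost everywhere equality.\<close>

lemma fourier_L2_dilate_cong_AE:
  fixes f g :: "'a::euclidean_space \<Rightarrow> complex"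
  assumes "f \<in> borel_measurable lebesgue" "g \<in> borel_measurable borel"
    and ae: "AE x in lebesgue. f x = g x" and t: "t > 0"
  shows "fourier_L2 s (dilate t f) = fourier_L2 s (dilate t g)"
proof (rule fourier_L2_cong_AE)
  have [measurable]: "(\<lambda>x. f (inverse t *\<^sub>R x)) \<in> borel_measurable lebesgue"
    by (rule measurable_compose[OF lebesgue_measurable_scaling assms(1)])
  show "dilate t f \<in> borel_measurable lebesgue"
    unfolding dilate_def[abs_def] by measurable
  show "dilate t g \<in> borel_measurable lebesgue"
    by (intro borel_imp_lebesgue_measurable measurable_dilate assms)
  have "AE x in lborel. f (inverse t *\<^sub>R x) = g (inverse t *\<^sub>R x)"
    by (rule AE_lborel_scaleR) (use ae t in \<open>auto simp: AE_completion_iff\<close>)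
  then show "AE x in lebesgue. dilate t f x = dilate t g x"
    by (intro AE_completion) (auto simp: dilate_def elim!: eventually_mono)
qed

lemma essentially_bounded_ex_bounded:
  assumes "essentially_bounded \<mu>"
  shows "\<exists>m M. m \<in> borel_measurable borel \<and> (\<forall>x. cmod (m x) \<le> M) \<and> (AE x in lebesgue. \<mu> x = m x)"
proof -
  have m: "\<mu> \<in> borel_measurable lebesgue" and fin: "Linf_norm \<mu> < \<infinity>"
    using assms by (auto simp: essentially_bounded_def)
  obtain g where [measurable]: "g \<in> borel_measurable borel" and g: "AE x in lebesgue. \<mu> x = g x"
    using lebesgue_measurable_ex_borel[OF m] by auto
  obtain M where M: "Linf_norm \<mu> \<le> ereal M"
    using fin ereal_dense2 less_imp_le by blast
  \<comment> \<open>\<open>max 0 M\<close> also bounds the value 0 assigned where \<open>g\<close>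
    is too large.\<close>
  define M' where "M' = max 0 M"
  have "AE x in lebesgue. ereal (cmod (\<mu> x)) \<le> Linf_norm \<mu>"
    unfolding Linf_norm_def by (rule esssup_AE)
  then have "AE x in lebesgue. \<mu> x = (if cmod (g x) \<le> M' then g x else 0)"
    using g
  proof eventually_elim
    case (elim x)
    then have "ereal (cmod (\<mu> x)) \<le> ereal M" using M by (metis order_trans)
    then show ?case using elim(2) by (auto simp: M'_def)
  qed
  moreover have "(\<lambda>x. if cmod (g x) \<le> M' then g x else 0) \<in> borel_measurable borel"
    by measurable
  moreover have "\<forall>x. cmod (if cmod (g x) \<le> M' then g x else 0) \<le> M'"
    by (auto simp: M'_def)
  ultimately show ?thesis by (intro exI[of _ "\<lambda>x. if cmod (g x) \<le> M' then g x else 0"] exI[of _ M'] conjI)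
qed

section \<open>Dilated symbols near frequency zero\<close>

lemma fourier_int_zero: "fourier_int s f 0 = integral\<^sup>L lebesgue f"
  by (simp add: fourier_int_def)

lemma fourier_int_seq_continuous:
  fixes f :: "'a::euclidean_space \<Rightarrow> complex"
  assumes f: "integrable lborel f" and X: "X \<longlonglongrightarrow> \<xi>"
  shows "(\<lambda>n. fourier_int s f (X n)) \<longlonglongrightarrow> fourier_int s f \<xi>"
proof -
  note [measurable] = borel_measurable_integrable[OF f, simplified]
  have "(\<lambda>n. \<integral>x. f x * cis (s * 2 * pi * (x \<bullet> X n)) \<partial>lborel) \<longlonglongrightarrow> (\<integral>x. f x * cis (s * 2 * pi * (x \<bullet> \<xi>)) \<partial>lborel)"
  proof (rule integral_dominated_convergence[where w = "\<lambda>x. cmod (f x)"])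
    show "AE x in lborel. (\<lambda>n. f x * cis (s * 2 * pi * (x \<bullet> X n))) \<longlonglongrightarrow> f x * cis (s * 2 * pi * (x \<bullet> \<xi>))"
      by (intro AE_I2 tendsto_intros X)
  qed (use f in \<open>auto simp: norm_mult\<close>)
  then show ?thesis by (simp add: fourier_int_lborel)
qed

text \<open>The transform of \<open>k\<close> is continuous and equals the integral of
  \<open>k\<close>, namely 1, at frequency 0. It is bounded by some \<open>K\<close>, so
  \<open>(K + 1) * cmod (F \<xi>)\<close> dominates for every \<open>t\<close>.\<close>

lemma fourier_int_dilation_L1_tendsto:
  fixes k F :: "'a::euclidean_space \<Rightarrow> complex"
  assumes k: "integrable lborel k" "(\<integral>x. k x \<partial>lborel) = 1" and F: "integrable lborel F"
  shows "((\<lambda>t. \<integral>\<^sup>+\<xi>. ennreal (cmod (fourier_int s k (t *\<^sub>R \<xi>) - 1) * cmod (F \<xi>)) \<partial>lborel) \<longlongrightarrow> 0) (at_right 0)"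
  unfolding tendsto_at_iff_sequentially comp_def
proof (intro allI impI)
  fix X :: "nat \<Rightarrow> real" assume X: "X \<longlonglongrightarrow> 0"
  note [measurable] = borel_measurable_integrable[OF k(1), simplified] borel_measurable_integrable[OF F, simplified]
  obtain K where K: "\<And>\<xi>. norm (fourier_int s k \<xi>) \<le> K"
    using norm_fourier_int_le by blast
  have K0: "K \<ge> 0" using K[of 0] norm_ge_zero order_trans by blast
  have k0: "fourier_int s k 0 = 1"
    using k(2) by (simp add: fourier_int_zero integral_completion)
  have "(\<lambda>n. \<integral>\<^sup>+\<xi>. ennreal (cmod (fourier_int s k (X n *\<^sub>R \<xi>) - 1) * cmod (F \<xi>)) \<partial>lborel) \<longlonglongrightarrow> integral\<^sup>N lborel (\<lambda>\<xi>::'a. 0)"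
  proof (rule nn_integral_dominated_convergence[where w = "\<lambda>\<xi>. ennreal ((K + 1) * cmod (F \<xi>))"])
    show "(\<integral>\<^sup>+\<xi>. ennreal ((K + 1) * cmod (F \<xi>)) \<partial>lborel) < \<infinity>"
      using F K0 by (simp add: integrable_iff_bounded ennreal_mult nn_integral_cmult ennreal_mult_less_top)
    show "AE \<xi> in lborel. ennreal (cmod (fourier_int s k (X n *\<^sub>R \<xi>) - 1) * cmod (F \<xi>)) \<le> ennreal ((K + 1) * cmod (F \<xi>))" for n
    proof (intro AE_I2 ennreal_leI mult_right_mono)
      fix \<xi> :: 'a
      show "cmod (fourier_int s k (X n *\<^sub>R \<xi>) - 1) \<le> K + 1"
        using norm_triangle_ineq4[of "fourier_int s k (X n *\<^sub>R \<xi>)" 1] K[of "X n *\<^sub>R \<xi>"] by simp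
    qed simp
    show "AE \<xi> in lborel. (\<lambda>n. ennreal (cmod (fourier_int s k (X n *\<^sub>R \<xi>) - 1) * cmod (F \<xi>))) \<longlonglongrightarrow> 0"
    proof (rule AE_I2)
      fix \<xi> :: 'a
      have "(\<lambda>n. X n *\<^sub>R \<xi>) \<longlonglongrightarrow> 0 *\<^sub>R \<xi>" by (intro tendsto_intros X)
      then have "(\<lambda>n. fourier_int s k (X n *\<^sub>R \<xi>)) \<longlonglongrightarrow> 1"
        using fourier_int_seq_continuous[OF k(1), of "\<lambda>n. X n *\<^sub>R \<xi>" 0 s] k0 by simp
      then have "(\<lambda>n. ennreal (cmod (fourier_int s k (X n *\<^sub>R \<xi>) - 1) * cmod (F \<xi>))) \<longlonglongrightarrow> ennreal (cmod (1 - 1) * cmod (F \<xi>))"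
        by (intro tendsto_ennrealI tendsto_intros)
      then show "(\<lambda>n. ennreal (cmod (fourier_int s k (X n *\<^sub>R \<xi>) - 1) * cmod (F \<xi>))) \<longlonglongrightarrow> 0" by simp
    qed
  qed measurable
  then show "(\<lambda>n. \<integral>\<^sup>+\<xi>. ennreal (cmod (fourier_int s k (X n *\<^sub>R \<xi>) - 1) * cmod (F \<xi>)) \<partial>lborel) \<longlonglongrightarrow> 0" by simp
qed

section \<open>Essential supremum bounds and the joint limit\<close>

lemma Linf_norm_nonneg: "Linf_norm (f :: 'a::euclidean_space \<Rightarrow> complex) \<ge> 0"
proof (cases "(\<lambda>x. ereal (cmod (f x))) \<in> borel_measurable lebesgue")
  case True
  \<comment> \<open>Positive measure of the space makes the essential supremum of the constant 0
    equal to 0; on a null space it would be minus infinity.\<close>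
  have "emeasure lebesgue (space (lebesgue :: 'a measure)) \<noteq> 0"
    by (simp add: emeasure_lborel_UNIV)
  then have "(0::ereal) = esssup (lebesgue :: 'a measure) (\<lambda>x. 0)"
    by (rule esssup_const[symmetric])
  also have "\<dots> \<le> Linf_norm f"
    unfolding Linf_norm_def by (rule esssup_mono) auto
  finally show ?thesis .
qed (simp add: Linf_norm_def esssup_non_measurable)

text \<open>On L^1 \<inter> L^2 both inverse transforms agree almost everywhere with Fourier
  integrals, and the modulus of a Fourier integral is at most the L^1 norm.\<close>

lemma Linf_norm_FT_inv_diff_le:
  fixes G H :: "'a::euclidean_space \<Rightarrow> complex"
  assumes G: "integrable lebesgue G" "square_integrable G"
    and H: "integrable lebesgue H" "square_integrable H"
  shows "Linf_norm (\<lambda>x. FT_inv G x - FT_inv H x) \<le> enn2ereal (\<integral>\<^sup>+\<xi>. ennreal (cmod (G \<xi> - H \<xi>)) \<partial>lborel)"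
  unfolding Linf_norm_def
proof (rule esssup_I)
  have [measurable]: "FT_inv G \<in> borel_measurable lebesgue" "FT_inv H \<in> borel_measurable lebesgue"
    using square_integrable_fourier_L2[OF G(2), of 1] square_integrable_fourier_L2[OF H(2), of 1]
    by (auto simp: square_integrable_def)
  show "(\<lambda>x. ereal (cmod (FT_inv G x - FT_inv H x))) \<in> borel_measurable lebesgue" by measurable
  have "ennreal (cmod (fourier_int 1 G x - fourier_int 1 H x)) \<le> (\<integral>\<^sup>+\<xi>. ennreal (cmod (G \<xi> - H \<xi>)) \<partial>lborel)" for x
    unfolding fourier_int_diff[OF G(1) H(1)]
    unfolding fourier_int_def
    by (rule order_trans[OF ennreal_norm_integral_le]) (simp add: norm_mult nn_integral_completion)
  then have "ereal (cmod (fourier_int 1 G x - fourier_int 1 H x)) \<le> enn2ereal (\<integral>\<^sup>+\<xi>. ennreal (cmod (G \<xi> - H \<xi>)) \<partial>lborel)" for x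
    by (metis enn2ereal_ennreal less_eq_ennreal.rep_eq norm_ge_zero)
  then show "AE x in lebesgue. ereal (cmod (FT_inv G x - FT_inv H x)) \<le> enn2ereal (\<integral>\<^sup>+\<xi>. ennreal (cmod (G \<xi> - H \<xi>)) \<partial>lborel)"
    using fourier_L2_AE_eq_fourier_int[OF G, of 1] fourier_L2_AE_eq_fourier_int[OF H, of 1]
    by (auto elim!: eventually_elim2)
qed

theorem theorem3p6:
  fixes \<mu> k hhat f :: "'a::euclidean_space \<Rightarrow> complex"
  assumes mu: "essentially_bounded \<mu>"
    and k: "integrable lebesgue k" "square_integrable k" "integral\<^sup>L lebesgue k = 1"
    and hhat: "integrable lebesgue hhat" "square_integrable hhat" "integral\<^sup>L lebesgue hhat = 1"
    and f: "square_integrable f" "integrable lebesgue (FT f)"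
  shows "((\<lambda>(\<alpha>, \<beta>).
            Linf_norm (\<lambda>x.
              FT_inv (\<lambda>\<xi>. \<mu> \<xi> * FT (dilate \<alpha> k) \<xi> *
                          FT (\<lambda>y. FT_inv (dilate \<beta> hhat) y * f y) \<xi>) x
              - FT_inv (\<lambda>\<xi>. \<mu> \<xi> * FT f \<xi>) x))
          \<longlongrightarrow> 0) (at_right 0 \<times>\<^sub>F at_right 0)"
proof -
  have reg: "\<exists>g. g \<in> borel_measurable borel \<and> (AE x in lebesgue. u x = g x) \<and> integrable lborel g \<and> square_integrable g \<and>
      integral\<^sup>L lborel g = integral\<^sup>L lebesgue u" if u: "integrable lebesgue u" "square_integrable u" for u :: "'a \<Rightarrow> complex"
  proof -
    have um: "u \<in> borel_measurable lebesgue" using u by auto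
    obtain g where g: "g \<in> borel_measurable borel" "AE x in lebesgue. u x = g x"
      using lebesgue_measurable_ex_borel[OF um] by auto
    have gm: "g \<in> borel_measurable lebesgue" using g(1) by (rule borel_imp_lebesgue_measurable)
    have "integrable lebesgue g" using integrable_cong_AE[OF um gm g(2)] u by simp
    moreover have "integral\<^sup>L lebesgue u = integral\<^sup>L lebesgue g" by (rule integral_cong_AE[OF um gm g(2)])
    moreover have "square_integrable g" using u(2) L2sq_cong_AE[OF g(2)] gm by (simp add: square_integrable_iff_L2sq)
    ultimately show ?thesis
      using g by (intro exI[of _ g]) (auto simp: integrable_completion integral_completion)
  qed
  obtain k' where k'm [measurable]: "k' \<in> borel_measurable borel" and k': "AE x in lebesgue. k x = k' x"
    "integrable lborel k'" "square_integrable k'" "integral\<^sup>L lborel k' = 1"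
    using reg[OF k(1,2)] k(3) by auto
  obtain h where hm [measurable]: "h \<in> borel_measurable borel" and h: "AE x in lebesgue. hhat x = h x"
    "integrable lborel h" "square_integrable h" "integral\<^sup>L lborel h = 1"
    using reg[OF hhat(1,2)] hhat(3) by auto
  obtain F where Fm [measurable]: "F \<in> borel_measurable borel" and F: "AE x in lebesgue. FT f x = F x"
    "integrable lborel F" "square_integrable F"
    using reg[OF f(2) square_integrable_fourier_L2[OF f(1)]] by auto
  have fm: "f \<in> borel_measurable lebesgue" using f(1) by (simp add: square_integrable_def)
  obtain f' where f'm [measurable]: "f' \<in> borel_measurable borel" and f': "AE x in lebesgue. f x = f' x"
    using lebesgue_measurable_ex_borel[OF fm] by auto
  have f'2: "square_integrable f'"
    using f(1) L2sq_cong_AE[OF f'] f'm by (simp add: square_integrable_iff_L2sq borel_imp_lebesgue_measurable)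
  obtain m M where mm [measurable]: "m \<in> borel_measurable borel" and mM: "\<And>x. cmod (m x) \<le> M"
    and m: "AE x in lebesgue. \<mu> x = m x"
    using essentially_bounded_ex_bounded[OF mu] by auto
  have mum: "\<mu> \<in> borel_measurable lebesgue" using mu by (simp add: essentially_bounded_def)
  have M0: "M \<ge> 0" using mM[of 0] norm_ge_zero order_trans by blast
  note b2l = borel_imp_lebesgue_measurable
  have FTf: "FT f = FT f'"
    by (rule fourier_L2_cong_AE[OF fm b2l[OF f'm] f'])
  have "has_fourier_L2 (- 1) f' (FT f')"
    by (rule has_fourier_L2_fourier_L2[OF f'2]) simp
  \<comment> \<open>The defining relation sees a candidate only through \<open>L2sq\<close> and
    square integrability, so the Borel function \<open>F\<close> may replace the chosen
    transform.\<close>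
  moreover have "L2sq (\<lambda>\<xi>. u \<xi> - FT f' \<xi>) = L2sq (\<lambda>\<xi>. u \<xi> - F \<xi>)" for u
    by (rule L2sq_cong_AE) (use F(1) FTf in \<open>auto elim!: eventually_mono\<close>)
  ultimately have f'F: "has_fourier_L2 (- 1) f' F"
    using F(3) by (simp add: has_fourier_L2_def)

  define K where "K = (\<integral>x. cmod (k' x) \<partial>lebesgue)"
  have K: "cmod (fourier_int (- 1) k' \<xi>) \<le> K" for \<xi>
    unfolding K_def by (rule norm_fourier_int_le)
  have K0: "K \<ge> 0" unfolding K_def by simp
  \<comment> \<open>\<open>A\<close> measures the smoothing error in frequency, \<open>B\<close>
    below the deviation of the dilated symbol from 1; each depends on one parameter.\<close>
  define A where "A \<beta> = (\<integral>\<^sup>+\<xi>. ennreal (cmod (convol (dilate \<beta> h) F \<xi> - F \<xi>)) \<partial>lborel)" for \<beta>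
  define B where "B \<alpha> = (\<integral>\<^sup>+\<xi>. ennreal (cmod (fourier_int (- 1) k' (\<alpha> *\<^sub>R \<xi>) - 1) * cmod (F \<xi>)) \<partial>lborel)" for \<alpha>

  define Q where "Q \<alpha> \<beta> = Linf_norm (\<lambda>x.
              FT_inv (\<lambda>\<xi>. \<mu> \<xi> * FT (dilate \<alpha> k) \<xi> * FT (\<lambda>y. FT_inv (dilate \<beta> hhat) y * f y) \<xi>) x
              - FT_inv (\<lambda>\<xi>. \<mu> \<xi> * FT f \<xi>) x)" for \<alpha> \<beta>
  have bound: "Q \<alpha> \<beta> \<le> enn2ereal (ennreal M * (ennreal K * A \<beta> + B \<alpha>))" if \<alpha>: "\<alpha> > 0" and \<beta>: "\<beta> > 0" for \<alpha> \<beta>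
  proof -
    define kh where "kh \<xi> = fourier_int (- 1) k' (\<alpha> *\<^sub>R \<xi>)" for \<xi>
    define C where "C = convol (dilate \<beta> h) F"
    define H where "H = fourier_int 1 (dilate \<beta> h)"
    have [measurable]: "kh \<in> borel_measurable borel" "C \<in> borel_measurable borel" "H \<in> borel_measurable borel"
      unfolding kh_def[abs_def] C_def H_def by measurable
    have dk: "integrable lborel (dilate \<alpha> k')" "square_integrable (dilate \<alpha> k')"
      and dh: "integrable lborel (dilate \<beta> h)" "square_integrable (dilate \<beta> h)"
      using k' h \<alpha> \<beta> by (auto intro: integrable_dilate square_integrable_dilate)
    have dk': "integrable lebesgue (dilate \<alpha> k')" and dh': "integrable lebesgue (dilate \<beta> h)"
      using dk dh by (simp_all add: integrable_completion)
    have FTk: "AE \<xi> in lebesgue. FT (dilate \<alpha> k) \<xi> = kh \<xi>"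
      using fourier_L2_AE_eq_fourier_int[OF dk' dk(2), of "- 1"] \<alpha> k k'
      by (simp add: fourier_int_dilate kh_def fourier_L2_dilate_cong_AE[OF borel_measurable_integrable[OF k(1)] k'm k'(1)])
    have FTh: "AE y in lebesgue. FT_inv (dilate \<beta> hhat) y = H y"
      using fourier_L2_AE_eq_fourier_int[OF dh' dh(2), of 1] \<beta>
      by (simp add: H_def fourier_L2_dilate_cong_AE[OF borel_measurable_integrable[OF hhat(1)] hm h(1)])
    have FThm: "FT_inv (dilate \<beta> hhat) \<in> borel_measurable lebesgue" and FTkm: "FT (dilate \<alpha> k) \<in> borel_measurable lebesgue"
      using square_integrable_fourier_L2[OF dh(2), of 1] square_integrable_fourier_L2[OF dk(2), of "- 1"] \<alpha> \<beta>
      by (simp_all add: square_integrable_def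
          fourier_L2_dilate_cong_AE[OF borel_measurable_integrable[OF hhat(1)] hm h(1)]
          fourier_L2_dilate_cong_AE[OF borel_measurable_integrable[OF k(1)] k'm k'(1)])
    have Hf: "square_integrable (\<lambda>y. H y * f' y)"
      unfolding H_def by (rule square_integrable_mult_bounded[OF _ norm_fourier_int_le f'2]) (rule b2l, measurable)
    have FTHf: "FT (\<lambda>y. FT_inv (dilate \<beta> hhat) y * f y) = FT (\<lambda>y. H y * f' y)"
    proof (rule fourier_L2_cong_AE)
      show "(\<lambda>y. FT_inv (dilate \<beta> hhat) y * f y) \<in> borel_measurable lebesgue"
        by (rule borel_measurable_times[OF FThm fm])
      show "(\<lambda>y. H y * f' y) \<in> borel_measurable lebesgue"
        using Hf by (simp add: square_integrable_def)
      show "AE y in lebesgue. FT_inv (dilate \<beta> hhat) y * f y = H y * f' y"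
        using FTh f' by eventually_elim simp
    qed
    \<comment> \<open>The signs are opposite here: \<open>H\<close> is an inverse transform and the
      outer transform is forward, so the product becomes convolution with the dilated
      \<open>h\<close>.\<close>
    have hasC: "has_fourier_L2 (- 1) (\<lambda>y. H y * f' y) C"
      unfolding H_def C_def by (rule has_fourier_L2_mult_fourier_int[OF dh(1) f'm f'2 F(2) f'F])
    have FTC: "AE \<xi> in lebesgue. FT (\<lambda>y. H y * f' y) \<xi> = C \<xi>"
      by (rule fourier_L2_AE_eqI[OF hasC Hf]) simp
    have FTHfm: "FT (\<lambda>y. H y * f' y) \<in> borel_measurable lebesgue"
      using square_integrable_fourier_L2[OF Hf, of "- 1"] by (simp add: square_integrable_def)
    have C2: "square_integrable C" using hasC by (simp add: has_fourier_L2_def)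
    have C1: "integrable lborel C"
    proof -
      have "(\<integral>\<^sup>+\<xi>. ennreal (cmod (C \<xi>)) \<partial>lborel) \<le>
          (\<integral>\<^sup>+\<eta>. ennreal (cmod (dilate \<beta> h \<eta>)) \<partial>lborel) * (\<integral>\<^sup>+\<xi>. ennreal (cmod (F \<xi>)) \<partial>lborel)"
        unfolding C_def by (rule nn_integral_convol_le) measurable
      also have "\<dots> < \<infinity>"
        using dh(1) F(2) by (simp add: integrable_iff_bounded ennreal_mult_less_top)
      finally show ?thesis by (simp add: integrable_iff_bounded)
    qed
    define G where "G \<xi> = m \<xi> * kh \<xi> * C \<xi>" for \<xi>
    define E where "E \<xi> = m \<xi> * F \<xi>" for \<xi>
    have [measurable]: "G \<in> borel_measurable borel" "E \<in> borel_measurable borel"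
      unfolding G_def[abs_def] E_def[abs_def] by measurable
    have mk: "cmod (m \<xi> * kh \<xi>) \<le> M * K" for \<xi>
      unfolding norm_mult kh_def by (rule mult_mono[OF mM K M0]) simp
    have G: "integrable lebesgue G" "square_integrable G"
    proof -
      have "integrable lborel G"
        unfolding G_def[abs_def] by (rule integrable_mult_bounded[OF _ mk C1]) measurable
      then show "integrable lebesgue G" by (simp add: integrable_completion)
      show "square_integrable G"
        unfolding G_def[abs_def] by (rule square_integrable_mult_bounded[OF _ mk C2]) (rule b2l, measurable)
    qed
    have E: "integrable lebesgue E" "square_integrable E"
    proof -
      have "integrable lborel E"
        unfolding E_def[abs_def] by (rule integrable_mult_bounded[OF _ mM F(2)]) measurable
      then show "integrable lebesgue E" by (simp add: integrable_completion)
      show "square_integrable E"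
        unfolding E_def[abs_def] by (rule square_integrable_mult_bounded[OF b2l[OF mm] mM F(3)])
    qed
    \<comment> \<open>An equality of functions, since \<open>fourier_L2\<close> depends only on the
      class of its argument; it can be rewritten inside \<open>Linf_norm\<close>.\<close>
    have eqG: "FT_inv (\<lambda>\<xi>. \<mu> \<xi> * FT (dilate \<alpha> k) \<xi> * FT (\<lambda>y. FT_inv (dilate \<beta> hhat) y * f y) \<xi>) = FT_inv G"
    proof (rule fourier_L2_cong_AE)
      show "(\<lambda>\<xi>. \<mu> \<xi> * FT (dilate \<alpha> k) \<xi> * FT (\<lambda>y. FT_inv (dilate \<beta> hhat) y * f y) \<xi>) \<in> borel_measurable lebesgue"
        unfolding FTHf by (intro borel_measurable_times mum FTkm FTHfm)
      show "G \<in> borel_measurable lebesgue" using G by auto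
      show "AE \<xi> in lebesgue. \<mu> \<xi> * FT (dilate \<alpha> k) \<xi> * FT (\<lambda>y. FT_inv (dilate \<beta> hhat) y * f y) \<xi> = G \<xi>"
        unfolding FTHf using m FTk FTC by eventually_elim (simp add: G_def)
    qed
    have eqE: "FT_inv (\<lambda>\<xi>. \<mu> \<xi> * FT f \<xi>) = FT_inv E"
    proof (rule fourier_L2_cong_AE)
      show "(\<lambda>\<xi>. \<mu> \<xi> * FT f \<xi>) \<in> borel_measurable lebesgue"
        by (intro borel_measurable_times mum borel_measurable_integrable[OF f(2)])
      show "E \<in> borel_measurable lebesgue" using E by auto
      show "AE \<xi> in lebesgue. \<mu> \<xi> * FT f \<xi> = E \<xi>"
        using m F(1) by eventually_elim (simp add: E_def)
    qed
    have "Q \<alpha> \<beta> \<le> enn2ereal (\<integral>\<^sup>+\<xi>. ennreal (cmod (G \<xi> - E \<xi>)) \<partial>lborel)"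
      unfolding Q_def eqG eqE by (rule Linf_norm_FT_inv_diff_le[OF G E])
    also have "(\<integral>\<^sup>+\<xi>. ennreal (cmod (G \<xi> - E \<xi>)) \<partial>lborel) \<le>
       (\<integral>\<^sup>+\<xi>. ennreal M * (ennreal K * ennreal (cmod (C \<xi> - F \<xi>)) + ennreal (cmod (kh \<xi> - 1) * cmod (F \<xi>))) \<partial>lborel)"
    proof (rule nn_integral_mono)
      fix \<xi>
      \<comment> \<open>Adding and subtracting \<open>kh \<xi> * F \<xi>\<close> pairs the bounded
        \<open>kh\<close> with the small \<open>C - F\<close>, and the small \<open>kh - 1\<close>
        with the integrable \<open>F\<close>.\<close>
      have "G \<xi> - E \<xi> = m \<xi> * (kh \<xi> * (C \<xi> - F \<xi>) + (kh \<xi> - 1) * F \<xi>)"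
        by (simp add: G_def E_def algebra_simps)
      then have "cmod (G \<xi> - E \<xi>) = cmod (m \<xi>) * cmod (kh \<xi> * (C \<xi> - F \<xi>) + (kh \<xi> - 1) * F \<xi>)"
        by (simp add: norm_mult)
      also have "\<dots> \<le> M * (K * cmod (C \<xi> - F \<xi>) + cmod (kh \<xi> - 1) * cmod (F \<xi>))"
      proof (rule mult_mono[OF mM _ M0])
        have "cmod (kh \<xi> * (C \<xi> - F \<xi>)) \<le> K * cmod (C \<xi> - F \<xi>)"
          unfolding norm_mult kh_def by (intro mult_right_mono K) simp
        then show "cmod (kh \<xi> * (C \<xi> - F \<xi>) + (kh \<xi> - 1) * F \<xi>) \<le> K * cmod (C \<xi> - F \<xi>) + cmod (kh \<xi> - 1) * cmod (F \<xi>)"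
          by (intro norm_triangle_le) (simp add: norm_mult)
      qed simp
      finally have "ennreal (cmod (G \<xi> - E \<xi>)) \<le> ennreal (M * (K * cmod (C \<xi> - F \<xi>) + cmod (kh \<xi> - 1) * cmod (F \<xi>)))"
        by (rule ennreal_leI)
      then show "ennreal (cmod (G \<xi> - E \<xi>)) \<le> ennreal M * (ennreal K * ennreal (cmod (C \<xi> - F \<xi>)) + ennreal (cmod (kh \<xi> - 1) * cmod (F \<xi>)))"
        using M0 K0 by (simp add: ennreal_mult ennreal_plus)
    qed
    also have "\<dots> = ennreal M * (ennreal K * A \<beta> + B \<alpha>)"
      unfolding A_def B_def C_def[symmetric] kh_def[symmetric]
      by (simp add: nn_integral_cmult nn_integral_add)
    finally show ?thesis by (simp add: less_eq_ennreal.rep_eq)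
  qed
  have limA: "(A \<longlongrightarrow> 0) (at_right 0)"
    unfolding A_def[abs_def] by (rule convol_dilate_L1_tendsto[OF h(2,4) F(2)])
  have limB: "(B \<longlongrightarrow> 0) (at_right 0)"
    unfolding B_def[abs_def] by (rule fourier_int_dilation_L1_tendsto[OF k'(2,4) F(2)])
  let ?P = "at_right (0::real) \<times>\<^sub>F at_right (0::real)"
  \<comment> \<open>Each term is a one-variable limit composed with a projection of the product
    filter.\<close>
  have "((\<lambda>p. ennreal M * (ennreal K * A (snd p) + B (fst p))) \<longlongrightarrow> ennreal M * (ennreal K * 0 + 0)) ?P"
    by (intro ennreal_tendsto_cmult tendsto_add filterlim_compose[OF limA filterlim_snd] filterlim_compose[OF limB filterlim_fst]) auto
  then have "((\<lambda>p. enn2ereal (ennreal M * (ennreal K * A (snd p) + B (fst p)))) \<longlongrightarrow> enn2ereal 0) ?P"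
    by (intro tendsto_enn2erealI) simp
  then have lim: "((\<lambda>p. enn2ereal (ennreal M * (ennreal K * A (snd p) + B (fst p)))) \<longlongrightarrow> 0) ?P"
    by (simp add: zero_ennreal.rep_eq)
  have "((\<lambda>p. Q (fst p) (snd p)) \<longlongrightarrow> 0) ?P"
  proof (rule tendsto_sandwich[OF _ _ tendsto_const lim])
    show "\<forall>\<^sub>F p in ?P. 0 \<le> Q (fst p) (snd p)"
      unfolding Q_def by (intro always_eventually allI Linf_norm_nonneg)
    have "\<forall>\<^sub>F p in ?P. 0 < fst p \<and> 0 < snd p"
      by (rule eventually_prodI[OF eventually_at_right_less eventually_at_right_less, THEN eventually_mono]) auto
    then show "\<forall>\<^sub>F p in ?P. Q (fst p) (snd p) \<le> enn2ereal (ennreal M * (ennreal K * A (snd p) + B (fst p)))"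
      by eventually_elim (rule bound, auto)
  qed
  then show ?thesis unfolding Q_def by (simp add: case_prod_beta')
qed

end
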